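(* Let $w$ be a permutation of $\mathbb{Z}_{\ge1}$ fixing all but finitely many integers, and let $\operatorname{Red}(w^{-1})$ be the set of reduced words of $w^{-1}$, each converted to an injective word in $\overline{\mathbb{Z}}$. Then $\operatorname{Red}(w^{-1})$ is a union of $\equiv$-classes, and letting $\mathcal{G}_w$ be the set of these classes, $$\mathfrak{S}_w=\sum_{\mathcal{C}\in\mathcal{G}_w}\mathfrak{P}_{F_{\mathcal C}},$$ where $F_{\mathcal C}$ is the indexed forest $F(W)$ common to all $W\in\mathcal C$. In particular $\mathfrak{S}_w$ expands in forest polynomials with nonnegative coefficients.
   Context: $\mathfrak{S}_w$ is the Schubert polynomial of Lascoux–Schützenberger. A reduced word $i_1\cdots i_k$ of $u$ satisfies $u=s_{i_1}\cdots s_{i_k}$ with $k=\ell(u)$ minimal. A word over $\mathbb{Z}$ is converted to a word over $\overline{\mathbb{Z}}$ by replacing the successive occurrences of each letter $i$, from left to right, by $(i,1),(i,2),\dots$. Indexed forests: for finite $S\subset\mathbb{Z}$ with maximal consecutive-integer blocks $I_1<\cdots<I_k$, an indexed forest $F$ with support $\mathrm{Supp}(F)=S$ consists of plane binary trees $T_1,\dots,T_k$, $T_j$ having $|I_j|$ nodes whose canonical labels are the elements of $I_j$ in inorder. Missing children count as leaves. $\operatorname{IN}(F)$ is the set of nodes. $\rho_F(v)$ is the canonical label of the node reached from $v$ by following left children as far as possible. The forest polynomial is $\mathfrak{P}_F=\sum_\kappa\prod_{v}x_{\kappa(v)}$ over $\kappa:\operatorname{IN}(F)\to\mathbb{Z}_{\ge1}$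 with $\kappa(v)\le\rho_F(v)$, $\kappa(\text{left child of }u)\ge\kappa(u)$ and $\kappa(\text{right child of }u)>\kappa(u)$. The empty forest gives $1$. $\overline{\mathbb{Z}}$ is the set of symbols $(i,j)$, $i\in\mathbb{Z}$, $j\ge1$, totally ordered lexicographically, with $\mathrm{val}(i,j)=i$. A word is injective if its letters are distinct. $\mathrm{INT}(u,F)$ is the set of canonical labels in the subtree rooted at $u$. $\mathsf{LBS}(F)$ is the set of injective $\rho:\operatorname{IN}(F)\to\overline{\mathbb{Z}}$ with $\rho(v)<\rho(u)$ for $v$ the left child of $u$, $\rho(u)<\rho(v)$ for $v$ the right child of $u$, and $\mathrm{val}(\rho(u))\in\mathrm{INT}(u,F)$. A decreasing labeling of $F$ is a bijection $\operatorname{IN}(F)\to\{1,\dots,|F|\}$ in which each node has a larger label than its children. Insertion: to an injective word $W$ associate an indexed forest $F(W)$, $P(W)\in\mathsf{LBS}(F(W))$ and a decreasing labeling $Q(W)$. For $W$ empty, $F(W)$ is empty. For $W=W'a$, let $F'=F(W')$, with support blocks $I_1<\cdots<I_k$, trees $T_j$, roots $u_j$ and root labels $a_j=P(W')(u_j)$, and let $i=\mathrm{val}(a)$. Add a new root $u$ as follows. (i) If $i\notin\mathrm{Supp}(F')$: $u$ gets canonical label $i$. Its left child is $u_j$ if $i-1\in I_j$ (otherwise none), and its right child is $u_{j'}$ if $i+1\in I_{j'}$ (otherwise none). (ii) If $i\in I_j$ and $a>a_j$: the left child of $u$ is $u_j$; its right child is $u_{j+1}$ if $\max I_j+2\in\mathrm{Supp}(F')$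 (otherwise none). The new support is $\mathrm{Supp}(F')\cup\{\max I_j+1\}$. (iii) If $i\in I_j$ and $a<a_j$: the right child of $u$ is $u_j$; its left child is $u_{j-1}$ if $\min I_j-2\in\mathrm{Supp}(F')$ (otherwise none). The new support is $\mathrm{Supp}(F')\cup\{\min I_j-1\}$. All other trees are unchanged. $P(W)$ extends $P(W')$ by $u\mapsto a$, and $Q(W)$ extends $Q(W')$ by $u\mapsto|W|$. Two injective words satisfy $W\equiv W'$ if $P(W)=P(W')$ (which entails $F(W)=F(W')$). *)

theory Defs
  imports
    "HOL-Library.Poly_Mapping"
    "HOL-Library.Product_Lexorder"
    "HOL-Library.FuncSet"
    "HOL-Library.Tree"
    "HOL-Combinatorics.Permutations"
begin

text \<open>Polynomials with integer coefficients in the variables \<open>x\<^sub>i\<close>, as finitely supported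
  functions on exponent vectors.\<close>

type_synonym mpoly = "(nat \<Rightarrow>\<^sub>0 nat) \<Rightarrow>\<^sub>0 int"

definition X :: "nat \<Rightarrow> mpoly" where
  "X i = Poly_Mapping.single (Poly_Mapping.single i 1) 1"

abbreviation adj :: "nat \<Rightarrow> nat \<Rightarrow> nat" where
  "adj i \<equiv> transpose i (Suc i)"

text \<open>\<open>Poly_Mapping.map_key f p\<close> is \<open>p \<circ> f\<close> for injective \<open>f\<close>; the inner occurrence permutes
  the exponents of a monomial, the outer one the coefficients of the polynomial.\<close>

definition swap_vars :: "nat \<Rightarrow> mpoly \<Rightarrow> mpoly" where
  "swap_vars i f = Poly_Mapping.map_key (Poly_Mapping.map_key (adj i)) f"

definition divided_diff :: "nat \<Rightarrow> mpoly \<Rightarrow> mpoly" where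
  "divided_diff i f = (THE g. (X i - X (Suc i)) * g = f - swap_vars i f)"

definition longest_perm :: "nat \<Rightarrow> nat \<Rightarrow> nat" where
  "longest_perm n i = (if 1 \<le> i \<and> i \<le> n then n + 1 - i else i)"

text \<open>Permutations of the positive integers are permutations of \<^typ>\<open>nat\<close> fixing \<open>0\<close>. The
  polynomial of the longest element of each \<open>S\<^sub>n\<close> is \<open>x\<^sub>1\<^bsup>n-1\<^esup>x\<^sub>2\<^bsup>n-2\<^esup>\<cdots>x\<^sub>n\<^sub>-\<^sub>1\<close>, and the
  polynomial of \<open>w s\<^sub>i\<close> is the divided difference of that of \<open>w\<close> at each descent \<open>i\<close> of \<open>w\<close>.\<close>

inductive is_schubert :: "(nat \<Rightarrow> nat) \<Rightarrow> mpoly \<Rightarrow> bool" where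
  longest: "is_schubert (longest_perm n) (\<Prod>i = 1..n. X i ^ (n - i))"
| descend: "is_schubert w f \<Longrightarrow> 1 \<le> i \<Longrightarrow> w (Suc i) < w i \<Longrightarrow>
    is_schubert (w \<circ> adj i) (divided_diff i f)"

definition schubert :: "(nat \<Rightarrow> nat) \<Rightarrow> mpoly" where
  "schubert w = (THE f. is_schubert w f)"

text \<open>A node is identified with its canonical label. A forest is the set of its trees, each tree
  carrying the canonical labels; the label sets of the trees are the maximal blocks of consecutive
  integers of the support.\<close>

type_synonym forest = "int tree set"

definition indexed_forest :: "forest \<Rightarrow> bool" where
  "indexed_forest F \<longleftrightarrow> finite F
    \<and> (\<forall>t\<in>F. t \<noteq> Leaf \<and> (\<exists>a b. inorder t = [a..b]))
    \<and> (\<forall>t\<in>F. \<forall>t'\<in>F. t \<noteq> t' \<longrightarrow> (\<forall>i\<in>set_tree t. \<forall>j\<in>set_tree t'. 2 \<le> \<bar>i - j\<bar>))"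

definition Supp :: "forest \<Rightarrow> int set" where
  "Supp F = (\<Union>t\<in>F. set_tree t)"

fun leftmost :: "'a tree \<Rightarrow> 'a" where
  "leftmost (Node l v r) = (if l = Leaf then v else leftmost l)"

definition forest_fillings :: "forest \<Rightarrow> (int \<Rightarrow> nat) set" where
  "forest_fillings F = {\<kappa> \<in> Supp F \<rightarrow>\<^sub>E {1..}. \<forall>t\<in>F. \<forall>l u r. Node l u r \<in> subtrees t \<longrightarrow>
      int (\<kappa> u) \<le> leftmost (Node l u r)
      \<and> (l \<noteq> Leaf \<longrightarrow> \<kappa> (value l) \<ge> \<kappa> u)
      \<and> (r \<noteq> Leaf \<longrightarrow> \<kappa> (value r) > \<kappa> u)}"

definition forest_poly :: "forest \<Rightarrow> mpoly" where
  "forest_poly F = (\<Sum>\<kappa>\<in>forest_fillings F. \<Prod>v\<in>Supp F. X (\<kappa> v))"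

text \<open>The order on pairs is the lexicographic one of \<^theory>\<open>HOL-Library.Product_Lexorder\<close>; that the
  second component is at least \<open>1\<close> is required of words, not by the type.\<close>

type_synonym letter = "int \<times> nat"

definition injective_words :: "letter list set" where
  "injective_words = {W. distinct W \<and> (\<forall>(i, j)\<in>set W. 1 \<le> j)}"

text \<open>A node carries its canonical label together with its label under \<open>P\<close>.\<close>

type_synonym ltree = "(int \<times> letter) tree"

definition canon :: "ltree \<Rightarrow> int set" where
  "canon t = fst ` set_tree t"

text \<open>The tree of the forest whose block contains a given integer; \<^term>\<open>Leaf\<close> if that integer is
  not in the support.\<close>

definition tree_at :: "ltree set \<Rightarrow> int \<Rightarrow> ltree" where
  "tree_at P i = (if \<exists>t\<in>P. i \<in> canon t then THE t. t \<in> P \<and> i \<in> canon t else Leaf)"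

definition add_root :: "int \<Rightarrow> letter \<Rightarrow> ltree set \<Rightarrow> ltree set" where
  "add_root c a P = (let L = tree_at P (c - 1); R = tree_at P (c + 1)
    in insert (Node L (c, a) R) (P - {L, R}))"

text \<open>When the new root has canonical label \<open>max I\<^sub>j + 1\<close>, the tree at the integer to its left is
  \<open>T\<^sub>j\<close>, and the one at the integer to its right is \<open>T\<^sub>j\<^sub>+\<^sub>1\<close> exactly if \<open>max I\<^sub>j + 2\<close> is in the support;
  symmetrically for \<open>min I\<^sub>j - 1\<close>. Existing nodes keep their canonical labels.\<close>

definition insert_letter :: "ltree set \<Rightarrow> letter \<Rightarrow> ltree set" where
  "insert_letter P a = (case tree_at P (fst a) of
      Leaf \<Rightarrow> add_root (fst a) a P
    | Node l (c, b) r \<Rightarrow>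
        if b < a then add_root (Max (canon (Node l (c, b) r)) + 1) a P
        else add_root (Min (canon (Node l (c, b) r)) - 1) a P)"

definition P_tableau :: "letter list \<Rightarrow> ltree set" where
  "P_tableau W = foldl insert_letter {} W"

definition forest_of :: "letter list \<Rightarrow> forest" where
  "forest_of W = map_tree fst ` P_tableau W"

definition word_equiv :: "(letter list \<times> letter list) set" where
  "word_equiv = {(W, W'). W \<in> injective_words \<and> W' \<in> injective_words \<and> P_tableau W = P_tableau W'}"

definition word_perm :: "nat list \<Rightarrow> nat \<Rightarrow> nat" where
  "word_perm is = foldr (\<lambda>i f. adj i \<circ> f) is id"

definition words_for :: "(nat \<Rightarrow> nat) \<Rightarrow> nat list set" where
  "words_for u = {is. set is \<subseteq> {1..} \<and> word_perm is = u}"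

definition perm_length :: "(nat \<Rightarrow> nat) \<Rightarrow> nat" where
  "perm_length u = (LEAST k. \<exists>is\<in>words_for u. length is = k)"

definition reduced_words :: "(nat \<Rightarrow> nat) \<Rightarrow> nat list set" where
  "reduced_words u = {is \<in> words_for u. length is = perm_length u}"

definition to_injective :: "int list \<Rightarrow> letter list" where
  "to_injective is = map (\<lambda>p. (is ! p, count_list (take (Suc p) is) (is ! p))) [0..<length is]"

definition Red :: "(nat \<Rightarrow> nat) \<Rightarrow> letter list set" where
  "Red u = (\<lambda>is. to_injective (map int is)) ` reduced_words u"

definition red_classes :: "(nat \<Rightarrow> nat) \<Rightarrow> letter list set set" where
  "red_classes w = {C \<in> injective_words // word_equiv. C \<subseteq> Red (inv w)}"

definition class_forest :: "letter list set \<Rightarrow> forest" where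
  "class_forest C = (THE F. \<forall>W\<in>C. forest_of W = F)"

end

theory Submission
  imports Defs
begin

text \<open>
  Let \<open>u\<^sub>1, u\<^sub>2, \<dots>\<close> generate the nil-Coxeter algebra and put \<open>A\<^sub>i(x) = (1 + x u\<^sub>i)(1 + x u\<^sub>i\<^sub>+\<^sub>1)\<cdots>\<close>. By the
  Yang-Baxter relation \<open>A\<^sub>i(x)\<close> and \<open>A\<^sub>i(y)\<close> commute, so the product \<open>\<cdots>A\<^sub>2(x\<^sub>2)A\<^sub>1(x\<^sub>1)\<close> satisfies the
  divided difference recursion of Schubert polynomials (Fomin and Stanley). Expanding it writes
  \<open>\<S>\<^sub>w\<close> as a sum over the reduced words of \<open>w\<^sup>-\<^sup>1\<close> and their compatible sequences.

  The words with a given insertion tableau are exactly the readings of its letters in an order in which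
  children precede their parents. Two such readings differ by commutations of letters whose values
  differ by at least \<open>2\<close>, because letters of incomparable nodes lie in separated intervals; hence the set
  of reduced words is a union of classes. A compatible sequence for a word of a class is a function \<open>\<kappa>\<close> on
  the nodes, and the word is recovered by sorting the nodes by decreasing \<open>\<kappa>\<close> and then by increasing
  letter. The functions for which this word is a linear extension are those obeying the
  inequalities that define the forest polynomial.
\<close>

section \<open>Operators of the nil-Coxeter algebra\<close>

text \<open>A value obtained by divided differences depends a priori on the path from a longest
  permutation. The sum \<open>bjs\<close> over compatible sequences mentions neither a path nor a
  bound n, and every derivation of \<open>is_schubert\<close> ends in it; this is what makes
  \<open>schubert\<close> well defined. The products \<open>A_i(x)\<close> are cut off at the
  generators \<open>u_j\<close> with j < n, for any n such that \<open>w\<close> permutes 1, ..., n,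
  so that all sums are finite. Two mismatches separate compatible sequences from fillings.
  Compatible sequences compare integer letters, whereas tableaux carry numbered letters; neighbours
  in a reduced word are different integers, so the numbers never decide a comparison of neighbours.
  And compatible sequences bound an index by the value of the letter, fillings by the left end of
  the subtree. A letter only has to lie somewhere in the interval of its subtree, so the two bounds
  differ node by node; they become equivalent once the parent-child inequalities hold on the whole
  tree.\<close>

lemma adj_simps [simp]:
  "adj i i = Suc i" "adj i (Suc i) = i" "j \<noteq> i \<Longrightarrow> j \<noteq> Suc i \<Longrightarrow> adj i j = j"
  by (auto simp: transpose_def)

lemma adj_adj [simp]: "adj i (adj i j) = j"
  by (simp add: transpose_def)

lemma adj_comp_adj [simp]: "w \<circ> adj i \<circ> adj i = w"
  by (auto simp: fun_eq_iff)

lemma adj_commute: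
  assumes "Suc i < j"
  shows "w \<circ> adj i \<circ> adj j = w \<circ> adj j \<circ> adj i"
  using assms by (auto simp: fun_eq_iff transpose_def)

lemma adj_braid: "w \<circ> adj i \<circ> adj (Suc i) \<circ> adj i = w \<circ> adj (Suc i) \<circ> adj i \<circ> adj (Suc i)"
  by (auto simp: fun_eq_iff transpose_def)

text \<open>The generators of the nil-Coxeter algebra in its right regular representation on functions of a
  permutation. Applied to the indicator function of the identity, a product of generators is nonzero
  at \<open>w\<close> iff its indices, read from left to right, form a reduced word of \<open>w\<^sup>-\<^sup>1\<close>.\<close>

definition nil_op :: "nat \<Rightarrow> ((nat \<Rightarrow> nat) \<Rightarrow> 'a::comm_ring_1) \<Rightarrow> (nat \<Rightarrow> nat) \<Rightarrow> 'a" where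
  "nil_op j \<phi> w = (if w (Suc j) < w j then \<phi> (w \<circ> adj j) else 0)"

definition nil_exp :: "nat \<Rightarrow> 'a \<Rightarrow> ((nat \<Rightarrow> nat) \<Rightarrow> 'a::comm_ring_1) \<Rightarrow> (nat \<Rightarrow> nat) \<Rightarrow> 'a" where
  "nil_exp j x \<phi> w = \<phi> w + x * nil_op j \<phi> w"

text \<open>The generator squares to zero: if \<open>w\<close> has a descent at i, then
  \<open>w \<circ> adj i\<close> has an ascent there, where \<open>nil_op i\<close>
  vanishes.\<close>

lemma nil_op_nil_exp_same: "nil_op i (nil_exp i x \<phi>) = nil_op i \<phi>"
  by (auto simp: fun_eq_iff nil_op_def nil_exp_def)

lemma nil_op_nil_op_commute:
  assumes "Suc i < j"
  shows "nil_op i (nil_op j \<phi>) = nil_op j (nil_op i \<phi>)"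
  by (use assms in \<open>auto simp: fun_eq_iff nil_op_def adj_commute [OF assms]\<close>)

lemma nil_op_linear: "nil_op i (\<lambda>w. f w + x * g w) w = nil_op i f w + x * nil_op i g w"
  by (simp add: nil_op_def)

lemma nil_op_nil_exp_commute:
  assumes "Suc i < j \<or> Suc j < i"
  shows "nil_op i (nil_exp j x \<phi>) = nil_exp j x (nil_op i \<phi>)"
proof
  fix w
  have "nil_op i (nil_op j \<phi>) = nil_op j (nil_op i \<phi>)"
    using assms nil_op_nil_op_commute by metis
  then show "nil_op i (nil_exp j x \<phi>) w = nil_exp j x (nil_op i \<phi>) w"
    by (simp add: nil_exp_def [abs_def] nil_op_linear)
qed

lemma nil_exp_linear: "nil_exp i y (\<lambda>w. f w + x * g w) w = nil_exp i y f w + x * nil_exp i y g w"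
  by (simp add: nil_exp_def nil_op_linear algebra_simps)

lemma nil_exp_commute:
  assumes "Suc i < j \<or> Suc j < i"
  shows "nil_exp i x (nil_exp j y \<phi>) = nil_exp j y (nil_exp i x \<phi>)"
proof
  fix w
  have "nil_exp i x (nil_exp j y \<phi>) w = nil_exp j y \<phi> w + x * nil_op i (nil_exp j y \<phi>) w"
    by (simp add: nil_exp_def [of i])
  also have "\<dots> = nil_exp j y (nil_exp i x \<phi>) w"
    by (simp add: nil_op_nil_exp_commute [OF assms] nil_exp_def [of i, abs_def] nil_exp_linear)
  finally show "nil_exp i x (nil_exp j y \<phi>) w = nil_exp j y (nil_exp i x \<phi>) w" .
qed

lemma nil_exp_add: "nil_exp i x (nil_exp i y \<phi>) = nil_exp i (x + y) \<phi>"
  by (auto simp: fun_eq_iff nil_exp_def nil_op_def algebra_simps)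

lemma nil_exp_0 [simp]: "nil_exp i 0 \<phi> = \<phi>"
  by (auto simp: fun_eq_iff nil_exp_def)

lemma nil_exp_cancel [simp]: "nil_exp i (- x) (nil_exp i x \<phi>) = \<phi>"
  by (simp add: nil_exp_add)

lemma nil_op_braid: "nil_op i (nil_op (Suc i) (nil_op i \<phi>)) = nil_op (Suc i) (nil_op i (nil_op (Suc i) \<phi>))"
  by (auto simp: fun_eq_iff nil_op_def adj_braid)

lemma nil_op_nil_op_same: "nil_op i (nil_op i \<phi>) w = 0"
  by (simp add: nil_op_def)

text \<open>For u, v with squares zero both sides expand to 1 + (x+y)(u+v) + x(x+y)uv + y(x+y)vu
  plus a cubic term, and the cubic terms agree by the braid relation.\<close>

lemma nil_exp_Yang_Baxter:
  "nil_exp i x (nil_exp (Suc i) (x + y) (nil_exp i y \<phi>)) = nil_exp (Suc i) y (nil_exp i (x + y) (nil_exp (Suc i) x \<phi>))"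
  by (rule ext, simp add: nil_exp_def [abs_def] nil_op_linear nil_op_nil_op_same fun_cong [OF nil_op_braid])
    (simp add: algebra_simps)

text \<open>The product \<open>A_i(x)\<close> cut off after m factors.\<close>

fun row_op :: "nat \<Rightarrow> nat \<Rightarrow> 'a \<Rightarrow> ((nat \<Rightarrow> nat) \<Rightarrow> 'a::comm_ring_1) \<Rightarrow> (nat \<Rightarrow> nat) \<Rightarrow> 'a" where
  "row_op i 0 x \<phi> = \<phi>"
| "row_op i (Suc m) x \<phi> = nil_exp i x (row_op (Suc i) m x \<phi>)"

lemma row_op_nil_exp_commute:
  assumes "Suc i < j"
  shows "row_op j m x (nil_exp i y \<phi>) = nil_exp i y (row_op j m x \<phi>)"
  using assms by (induction m arbitrary: j) (simp_all add: nil_exp_commute)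

text \<open>Splitting x = y + (x - y) in the outer factor exposes the Yang-Baxter relation with
  parameters x - y and y. The parameters trade places at the price of a trailing factor in the
  generator \<open>Suc i\<close>.\<close>

lemma nil_exp_exchange:
  "nil_exp i x (nil_exp (Suc i) x (nil_exp i y \<phi>)) = nil_exp i y (nil_exp (Suc i) y (nil_exp i x (nil_exp (Suc i) (x - y) \<phi>)))"
proof -
  have "nil_exp i x (nil_exp (Suc i) x (nil_exp i y \<phi>)) = nil_exp i y (nil_exp i (x - y) (nil_exp (Suc i) (x - y + y) (nil_exp i y \<phi>)))"
    by (simp add: nil_exp_add)
  also have "\<dots> = nil_exp i y (nil_exp (Suc i) y (nil_exp i x (nil_exp (Suc i) (x - y) \<phi>)))"
    by (subst nil_exp_Yang_Baxter) simp
  finally show ?thesis .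
qed

lemma row_op_commute: "row_op i m x (row_op i m y \<phi>) = row_op i m y (row_op i m x \<phi>)"
proof (induction m arbitrary: i \<phi>)
  case (Suc m)
  show ?case
  proof (cases m)
    case 0
    then show ?thesis by (simp add: nil_exp_add add.commute)
  next
    case (Suc k)
    let ?A = "row_op (Suc i) m" and ?B = "row_op (Suc (Suc i)) k"
    have A: "?A z \<psi> = nil_exp (Suc i) z (?B z \<psi>)" for z \<psi>
      by (simp add: Suc)
    have comm: "?B u (nil_exp i v \<psi>) = nil_exp i v (?B u \<psi>)" for u v \<psi>
      by (simp add: row_op_nil_exp_commute)
    have "row_op i (Suc m) x (row_op i (Suc m) y \<phi>) = nil_exp i x (nil_exp (Suc i) x (nil_exp i y (?B x (?A y \<phi>))))"
      by (simp add: A comm)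
    \<comment> \<open>The trailing parameter x - y is split: x completes \<open>?B x\<close> to the
      full row \<open>?A x\<close>, and -y is kept to strip the first factor from
      \<open>?A y\<close> once the induction hypothesis has moved that row to the front.\<close>
    also have "\<dots> = nil_exp i y (nil_exp (Suc i) y (nil_exp i x (nil_exp (Suc i) (- y) (?A x (?A y \<phi>)))))"
      by (subst nil_exp_exchange) (simp add: A nil_exp_add)
    also have "\<dots> = nil_exp i y (nil_exp (Suc i) y (nil_exp i x (nil_exp (Suc i) (- y) (?A y (?A x \<phi>)))))"
      by (simp add: Suc.IH)
    also have "\<dots> = nil_exp i y (nil_exp (Suc i) y (nil_exp i x (?B y (?A x \<phi>))))"
      by (simp add: A)
    also have "\<dots> = row_op i (Suc m) y (row_op i (Suc m) x \<phi>)"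
      by (simp add: A comm)
    finally show ?thesis .
  qed
qed simp

section \<open>Divided differences\<close>

lemma poly_mapping_induct_add [case_names zero single]:
  assumes "P 0" "\<And>p k (v::'b::comm_monoid_add). P p \<Longrightarrow> P (Poly_Mapping.single k v + p)"
  shows "P (f :: 'a \<Rightarrow>\<^sub>0 'b)"
proof -
  have "P (\<Sum>k\<in>K. Poly_Mapping.single k (Poly_Mapping.lookup f k))" if "finite K" for K
    using that by (induction K) (auto intro: assms)
  moreover have "f = (\<Sum>k\<in>Poly_Mapping.keys f. Poly_Mapping.single k (Poly_Mapping.lookup f k))"
    by (rule poly_mapping_eqI)
      (auto simp: lookup_sum lookup_single when_def in_keys_iff cong: if_cong)
  ultimately show ?thesis
    by (metis finite_keys)
qed

abbreviation swap_exps :: "nat \<Rightarrow> (nat \<Rightarrow>\<^sub>0 nat) \<Rightarrow> nat \<Rightarrow>\<^sub>0 nat" where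
  "swap_exps i \<equiv> Poly_Mapping.map_key (adj i)"

lemma swap_exps_swap_exps [simp]: "swap_exps i (swap_exps i m) = m"
  by (simp add: map_key_compose map_key_id comp_def)

lemma inj_swap_exps: "inj (swap_exps i)"
  by (metis injI swap_exps_swap_exps)

lemma swap_exps_add: "swap_exps i (m + m') = swap_exps i m + swap_exps i m'"
  by (simp add: map_key_plus)

lemma swap_vars_single:
  "swap_vars i (Poly_Mapping.single m c) = Poly_Mapping.single (swap_exps i m) c"
  unfolding swap_vars_def
  using map_key_single [OF inj_swap_exps, of i "swap_exps i m" c] by simp

lemma swap_vars_add: "swap_vars i (f + g) = swap_vars i f + swap_vars i g"
  by (simp add: swap_vars_def map_key_plus inj_swap_exps)

lemma swap_vars_0 [simp]: "swap_vars i 0 = 0"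
  by (simp add: swap_vars_def map_key_zero inj_swap_exps)

lemma swap_vars_1 [simp]: "swap_vars i 1 = 1"
  using swap_vars_single [of i 0 1] by simp

lemma swap_vars_mult: "swap_vars i (f * g) = swap_vars i f * swap_vars i g"
proof (induction f rule: poly_mapping_induct_add)
  case (single p k v)
  have "swap_vars i (Poly_Mapping.single k v * g) = swap_vars i (Poly_Mapping.single k v) * swap_vars i g"
    by (induction g rule: poly_mapping_induct_add)
      (simp_all add: swap_vars_add swap_vars_single distrib_left mult_single swap_exps_add)
  then show ?case
    by (simp add: distrib_right swap_vars_add single)
qed simp

lemma swap_vars_X: "swap_vars i (X j) = X (adj i j)"
proof -
  have "swap_exps i (Poly_Mapping.single j 1) = Poly_Mapping.single (adj i j) 1"
    using map_key_single [of "adj i" "adj i j" "1 :: nat"] by simp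
  then show ?thesis
    by (simp add: X_def swap_vars_single)
qed

lemma X_eq_iff: "X i = X j \<longleftrightarrow> i = j"
proof
  assume "X i = X j"
  then have "Poly_Mapping.keys (X i) = Poly_Mapping.keys (X j)" by simp
  then have "Poly_Mapping.single i (1::nat) = Poly_Mapping.single j 1"
    by (simp add: X_def)
  then have "Poly_Mapping.keys (Poly_Mapping.single i (1::nat)) = Poly_Mapping.keys (Poly_Mapping.single j (1::nat))"
    by simp
  then show "i = j" by simp
qed simp

text \<open>The polynomial ring has no zero divisors and \<open>X i\<close> differs from
  \<open>X (Suc i)\<close>, so the quotient in the definite description is unique.\<close>

lemma divided_diff_eqI:
  assumes "f - swap_vars i f = (X i - X (Suc i)) * g"
  shows "divided_diff i f = g"
  unfolding divided_diff_def
  using assms by (intro the_equality) (auto simp: X_eq_iff)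

lemma swap_vars_nil_exp:
  "(\<lambda>w. swap_vars i (nil_exp j x \<phi> w)) = nil_exp j (swap_vars i x) (\<lambda>w. swap_vars i (\<phi> w))"
  by (auto simp: fun_eq_iff nil_exp_def nil_op_def swap_vars_add swap_vars_mult)

lemma swap_vars_row_op:
  "(\<lambda>w. swap_vars i (row_op j m x \<phi> w)) = row_op j m (swap_vars i x) (\<lambda>w. swap_vars i (\<phi> w))"
  by (induction m arbitrary: j) (simp_all add: swap_vars_nil_exp)

section \<open>The truncated product and its divided differences\<close>

definition delta :: "(nat \<Rightarrow> nat) \<Rightarrow> mpoly" where
  "delta w = (if w = id then 1 else 0)"

fun rows_op :: "nat \<Rightarrow> nat \<Rightarrow> (nat \<Rightarrow> nat) \<Rightarrow> mpoly" where
  "rows_op n 0 = delta"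
| "rows_op n (Suc k) = row_op (Suc k) (n - Suc k) (X (Suc k)) (rows_op n k)"

text \<open>Only the variables with indices 1, ..., k occur in the first k rows.\<close>

lemma swap_vars_rows_op:
  assumes "k < i"
  shows "(\<lambda>w. swap_vars i (rows_op n k w)) = rows_op n k"
  using assms by (induction k) (auto simp: swap_vars_row_op swap_vars_X delta_def fun_eq_iff)

text \<open>The relation expresses that \<open>nil_op i\<close> computes the divided difference of
  \<open>G\<close>. A further factor on the left preserves it if its generator commutes with
  \<open>nil_op i\<close> and its parameter is symmetric in the two variables.\<close>

lemma divided_diff_relation_nil_exp:
  assumes "\<And>w. G w - swap_vars i (G w) = (X i - X (Suc i)) * nil_op i G w"
    and "Suc i < j" "swap_vars i z = z"
  shows "nil_exp j z G w - swap_vars i (nil_exp j z G w) = (X i - X (Suc i)) * nil_op i (nil_exp j z G) w"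
proof -
  have "nil_exp j z G w - swap_vars i (nil_exp j z G w) = (G w - swap_vars i (G w))
      + (if w (Suc j) < w j then z * (G (w \<circ> adj j) - swap_vars i (G (w \<circ> adj j))) else 0)"
    using assms(3) by (simp add: nil_exp_def nil_op_def swap_vars_add swap_vars_mult algebra_simps)
  also have "\<dots> = (X i - X (Suc i)) * nil_exp j z (nil_op i G) w"
    unfolding assms(1) by (simp add: nil_exp_def nil_op_def [of j] algebra_simps)
  finally show ?thesis
    using assms(2) by (simp add: nil_op_nil_exp_commute)
qed

lemma divided_diff_relation_row_op:
  assumes "\<And>w. G w - swap_vars i (G w) = (X i - X (Suc i)) * nil_op i G w"
    and "Suc i < j" "swap_vars i z = z"
  shows "row_op j m z G w - swap_vars i (row_op j m z G w) = (X i - X (Suc i)) * nil_op i (row_op j m z G) w"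
  using assms(2)
proof (induction m arbitrary: j w)
  case (Suc m)
  then show ?case
    using divided_diff_relation_nil_exp [of "row_op (Suc j) m z G" i j z w] assms(3) by simp
qed (use assms in simp)

text \<open>Rows \<open>i\<close> and \<open>Suc i\<close> produce the relation; every later row
  starts beyond \<open>Suc i\<close> in another variable and preserves it.\<close>

lemma divided_diff_relation_rows_op:
  assumes "1 \<le> i" "i < n" "Suc i \<le> k"
  shows "rows_op n k w - swap_vars i (rows_op n k w) = (X i - X (Suc i)) * nil_op i (rows_op n k) w"
  using assms(3)
proof (induction k arbitrary: w rule: dec_induct)
  case base
  obtain h where h: "i = Suc h" using assms(1) by (cases i) auto
  obtain m where m: "n - i = Suc m" using assms(2) by (cases "n - i") auto
  then have m': "n - Suc i = m" by simp
  \<comment> \<open>\<open>\<Phi>\<close> is symmetric in \<open>x\<^sub>i\<close> and \<open>x\<^sub>i\<^sub>+\<^sub>1\<close>, so only the factor \<open>1 - x\<^sub>i\<^sub>+\<^sub>1 u\<^sub>i\<close> in front of it contributes.\<close>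
  define \<Phi> where "\<Phi> = row_op i (Suc m) (X (Suc i)) (row_op i (Suc m) (X i) (rows_op n h))"
  \<comment> \<open>Row \<open>Suc i\<close> is a row starting at \<open>i\<close>, in the same
    variable, without its first factor; the negative parameter removes that factor.\<close>
  have G: "rows_op n (Suc i) = nil_exp i (- X (Suc i)) \<Phi>"
    using m m' h by (simp add: \<Phi>_def)
  have inv: "(\<lambda>w. swap_vars i (\<Phi> w)) = \<Phi>"
    by (simp only: \<Phi>_def swap_vars_row_op swap_vars_X swap_vars_rows_op h lessI adj_simps)
      (rule row_op_commute)
  then have inv': "swap_vars i (\<Phi> w) = \<Phi> w" for w by metis
  have "swap_vars i (- X (Suc i)) = - X i"
    using swap_vars_add [of i "X (Suc i)" "- X (Suc i)"]
    by (simp add: swap_vars_X add_eq_0_iff)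
  then have "(\<lambda>w. swap_vars i (rows_op n (Suc i) w)) = nil_exp i (- X i) \<Phi>"
    unfolding G swap_vars_nil_exp inv by simp
  then have "swap_vars i (rows_op n (Suc i) w) = nil_exp i (- X i) \<Phi> w"
    by metis
  then show ?case
    unfolding G nil_op_nil_exp_same by (simp add: nil_exp_def algebra_simps)
next
  case (step k)
  then show ?case
    by (simp add: divided_diff_relation_row_op swap_vars_X)
qed

lemma divided_diff_rows_op:
  assumes "1 \<le> i" "i < n" "w (Suc i) < w i"
  shows "divided_diff i (rows_op n n w) = rows_op n n (w \<circ> adj i)"
  using divided_diff_relation_rows_op [of i n n w] assms by (intro divided_diff_eqI) (simp add: nil_op_def)

section \<open>The formula of Billey, Jockusch and Stanley\<close>

text \<open>A word together with a weakly decreasing sequence of indices that drops strictly at the descents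
  of the word is the same as a list of pairs that is strictly sorted by this linear order, hence the
  same as the set of these pairs.\<close>

definition prec :: "'a::linorder \<times> nat \<Rightarrow> 'a \<times> nat \<Rightarrow> bool" where
  "prec p q \<longleftrightarrow> snd q < snd p \<or> snd p = snd q \<and> fst p < fst q"

lemma transp_prec: "transp prec"
  by (auto simp: transp_def prec_def)

lemma prec_linear: "p \<noteq> q \<Longrightarrow> prec p q \<or> prec q p"
  by (auto simp: prec_def prod_eq_iff)

lemma prec_asym: "prec p q \<Longrightarrow> \<not> prec q p"
  by (auto simp: prec_def)

lemma sorted_prec_distinct: "sorted_wrt prec ps \<Longrightarrow> distinct ps"
  by (induction ps) (auto simp: prec_def)

lemma sorted_prec_unique:
  assumes "sorted_wrt prec ps" "sorted_wrt prec qs" "set ps = set qs"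
  shows "ps = qs"
  using assms
proof (induction ps arbitrary: qs)
  case (Cons p ps)
  then obtain q qs' where qs: "qs = q # qs'" by (cases qs) auto
  have "p = q"
  proof (rule ccontr)
    assume "p \<noteq> q"
    then have "prec q p" "prec p q" using Cons.prems qs by auto
    then show False using prec_asym by blast
  qed
  moreover have "set ps = set qs'"
    using Cons.prems qs \<open>p = q\<close> sorted_prec_distinct [OF Cons.prems(1)]
      sorted_prec_distinct [OF Cons.prems(2)] by (auto simp: insert_ident)
  ultimately show ?case
    using Cons qs by auto
qed simp

lemma ex_sorted_prec:
  assumes "finite A"
  shows "\<exists>ps. sorted_wrt prec ps \<and> set ps = A"
  using assms
proof (induction A)
  case (insert p A)
  then obtain ps where ps: "sorted_wrt prec ps" "set ps = A" by auto
  let ?l = "filter (\<lambda>q. prec q p) ps" and ?r = "filter (prec p) ps"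
  have "sorted_wrt prec (?l @ p # ?r)"
    using ps(1)
    by (simp add: sorted_wrt_append sorted_wrt_filter) (auto simp: prec_def)
  moreover have "set (?l @ p # ?r) = insert p A"
    using ps(2) insert(2) by (auto, metis prec_linear)
  ultimately show ?case by blast
qed auto

text \<open>Expanding a product of factors sums over sublists of the list of factors; this
  identifies them with the sorted lists of pairs in the formula.\<close>

lemma subseqs_sorted_prec:
  assumes "sorted_wrt prec L"
  shows "set (subseqs L) = {ys. sorted_wrt prec ys \<and> set ys \<subseteq> set L}"
  using assms
proof (induction L)
  case (Cons p L)
  have IH: "set (subseqs L) = {ys. sorted_wrt prec ys \<and> set ys \<subseteq> set L}"
    using Cons by auto
  have "ys \<in> Cons p ` set (subseqs L) \<union> set (subseqs L) \<longleftrightarrow>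
      sorted_wrt prec ys \<and> set ys \<subseteq> insert p (set L)" for ys
  proof (cases ys)
    case Nil
    then show ?thesis using IH by auto
  next
    case (Cons q zs)
    have "p \<notin> set L" using sorted_prec_distinct [OF Cons.prems] by simp
    show ?thesis
    proof (cases "q = p")
      case True
      have "\<forall>z\<in>set zs. prec p z \<Longrightarrow> p \<notin> set zs" by (auto simp: prec_def)
      then show ?thesis
        using True \<open>p \<notin> set L\<close> Cons.prems unfolding Cons IH by auto
    next
      case False
      have "p \<notin> set zs" if "\<forall>z\<in>set zs. prec q z" "q \<in> set L"
        using that Cons.prems by (auto dest: prec_asym)
      then show ?thesis
        using False unfolding Cons IH by auto
    qed
  qed
  then show ?case by (auto simp: Let_def)
qed auto

text \<open>The reduced words of \<open>w\<^sup>-\<^sup>1\<close>, as sequences of descents that sort \<open>w\<close>.\<close>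

fun chain :: "(nat \<Rightarrow> nat) \<Rightarrow> nat list \<Rightarrow> bool" where
  "chain w [] \<longleftrightarrow> w = id"
| "chain w (j # js) \<longleftrightarrow> w (Suc j) < w j \<and> chain (w \<circ> adj j) js"

definition weight :: "('a \<times> nat) list \<Rightarrow> mpoly" where
  "weight ps = prod_list (map (\<lambda>p. X (snd p)) ps)"

lemma weight_simps [simp]: "weight [] = 1" "weight (p # ps) = X (snd p) * weight ps"
  by (simp_all add: weight_def)

abbreviation apply_nil_exp :: "(nat \<times> nat) list \<Rightarrow> ((nat \<Rightarrow> nat) \<Rightarrow> mpoly) \<Rightarrow> (nat \<Rightarrow> nat) \<Rightarrow> mpoly" where
  "apply_nil_exp \<equiv> foldr (\<lambda>(j, a). nil_exp j (X a))"

text \<open>Each factor contributes 1 or a variable times a generator. The chosen generators form a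
  sublist, and its term survives at \<open>w\<close> exactly if they lead from \<open>w\<close> down
  to the identity through descents.\<close>

lemma apply_nil_exp_delta:
  "apply_nil_exp L delta w = (\<Sum>ys\<leftarrow>subseqs L. if chain w (map fst ys) then weight ys else 0)"
proof (induction L arbitrary: w)
  case Nil
  then show ?case by (simp add: delta_def)
next
  case (Cons p L)
  have "(\<Sum>ys\<leftarrow>subseqs L. if chain w (map fst (p # ys)) then weight (p # ys) else 0)
      = X (snd p) * (if w (Suc (fst p)) < w (fst p) then
        (\<Sum>ys\<leftarrow>subseqs L. if chain (w \<circ> adj (fst p)) (map fst ys) then weight ys else 0) else 0)"
    by (auto simp: sum_list_const_mult [symmetric] if_distrib cong: if_cong)
  moreover have "apply_nil_exp (p # L) delta w = apply_nil_exp L delta w + X (snd p) *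
      (if w (Suc (fst p)) < w (fst p) then apply_nil_exp L delta (w \<circ> adj (fst p)) else 0)"
    by (simp add: nil_exp_def nil_op_def case_prod_unfold)
  ultimately show ?case
    by (simp only: Cons.IH) (simp add: Let_def comp_def add.commute)
qed

text \<open>The generators and variables of the factors of \<open>rows_op n k\<close>, from left to
  right.\<close>

fun staircase :: "nat \<Rightarrow> nat \<Rightarrow> (nat \<times> nat) list" where
  "staircase n 0 = []"
| "staircase n (Suc k) = map (\<lambda>j. (j, Suc k)) [Suc k..<n] @ staircase n k"

lemma apply_nil_exp_row: "apply_nil_exp (map (\<lambda>j. (j, a)) [i..<i + m]) \<phi> = row_op i m (X a) \<phi>"
proof (induction m arbitrary: i)
  case (Suc m)
  have "[i..<i + Suc m] = i # [Suc i..<Suc i + m]"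
    by (simp add: upt_rec)
  then show ?case
    using Suc [of "Suc i"] by (simp del: upt_Suc)
qed simp

lemma rows_op_eq_apply_nil_exp: "rows_op n k = apply_nil_exp (staircase n k) delta"
proof (induction k)
  case (Suc k)
  have "[Suc k..<n] = [Suc k..<Suc k + (n - Suc k)]" by (cases "Suc k \<le> n") auto
  then show ?case
    using Suc apply_nil_exp_row [of "Suc k" "Suc k" "n - Suc k"] by (simp del: upt_Suc)
qed simp

lemma set_staircase: "set (staircase n k) = {(j, a). 1 \<le> a \<and> a \<le> k \<and> a \<le> j \<and> j < n}"
proof (induction k)
  case (Suc k)
  show ?case
    unfolding staircase.simps set_append set_map set_upt Suc.IH by (auto simp: le_Suc_eq)
qed simp

lemma sorted_staircase: "sorted_wrt prec (staircase n k)"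
proof (induction k)
  case (Suc k)
  have "sorted_wrt (\<lambda>i j. prec (i, Suc k) (j, Suc k)) [Suc k..<n]"
    by (simp add: prec_def del: upt_Suc)
  then show ?case
    using Suc by (auto simp: sorted_wrt_append sorted_wrt_map set_staircase prec_def simp del: upt_Suc)
qed simp

text \<open>The words are those of the inverse, that is, reduced words of \<open>w\<close> read
  backwards; hence the indices decrease where the usual formula has them increase.\<close>

definition compatible_pairs :: "(nat \<Rightarrow> nat) \<Rightarrow> (nat \<times> nat) list set" where
  "compatible_pairs w = {ps. sorted_wrt prec ps \<and> (\<forall>(j, a)\<in>set ps. 1 \<le> a \<and> a \<le> j)
    \<and> chain w (map fst ps)}"

definition bjs :: "(nat \<Rightarrow> nat) \<Rightarrow> mpoly" where
  "bjs w = (\<Sum>ps\<in>compatible_pairs w. weight ps)"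

lemma permutes_comp_adj:
  assumes "w permutes {1..n}" "1 \<le> j" "j < n"
  shows "w \<circ> adj j permutes {1..n}"
  using assms by (intro permutes_compose permutes_swap_id) auto

lemma descent_in_range:
  assumes "w permutes {1..n}" "w (Suc j) < w j"
  shows "1 \<le> j \<and> j < n"
proof -
  have fixed: "w i = i" if "i = 0 \<or> n < i" for i
    using that permutes_not_in [OF assms(1)] by fastforce
  have "w i \<le> n" if "i \<le> n" for i
  proof (cases "i = 0")
    case False
    then show ?thesis using permutes_in_image [OF assms(1), of i] that by auto
  qed (simp add: fixed)
  then show ?thesis
    using assms(2) fixed [of j] fixed [of "Suc j"] by (metis Suc_leI leI le_SucI linorder_not_less not_less0
        order.strict_trans1 less_one lessI)
qed

lemma chain_in_range:
  assumes "w permutes {1..n}" "chain w js"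
  shows "set js \<subseteq> {1..<n}"
  using assms
proof (induction js arbitrary: w)
  case (Cons j js)
  then show ?case
    using descent_in_range [of w n j] permutes_comp_adj [of w n j] by auto
qed simp

text \<open>Chains of a permutation of 1, ..., n use only generators below n, so the bound built
  into the staircase excludes nothing and \<open>bjs\<close> does not depend on n.\<close>

lemma compatible_pairs_eq:
  assumes "w permutes {1..n}"
  shows "compatible_pairs w = {ps \<in> set (subseqs (staircase n n)). chain w (map fst ps)}"
proof -
  have "(\<forall>(j, a)\<in>set ps. 1 \<le> a \<and> a \<le> j) \<longleftrightarrow> set ps \<subseteq> set (staircase n n)"
    if "chain w (map fst ps)" for ps
  proof -
    have "j < n" if "(j, a) \<in> set ps" for j a
      using chain_in_range [OF assms \<open>chain w (map fst ps)\<close>] that by force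
    then show ?thesis by (fastforce simp: set_staircase)
  qed
  then show ?thesis
    unfolding compatible_pairs_def subseqs_sorted_prec [OF sorted_staircase] by blast
qed

lemma bjs_eq_rows_op:
  assumes "w permutes {1..n}"
  shows "bjs w = rows_op n n w"
proof -
  have "distinct (subseqs (staircase n n))"
    using distinct_set_subseqs [OF sorted_prec_distinct [OF sorted_staircase]] distinct_map by blast
  then have "rows_op n n w = (\<Sum>ys\<in>set (subseqs (staircase n n)). if chain w (map fst ys) then weight ys else 0)"
    by (simp add: rows_op_eq_apply_nil_exp apply_nil_exp_delta sum_list_distinct_conv_sum_set)
  then show ?thesis
    by (simp add: bjs_def compatible_pairs_eq [OF assms] sum.inter_filter)
qed

section \<open>Schubert polynomials and reduced words\<close>

definition inversions :: "(nat \<Rightarrow> nat) \<Rightarrow> (nat \<times> nat) set" where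
  "inversions w = {(a, b). a < b \<and> w b < w a}"

lemma inversions_subset:
  assumes "w permutes {1..n}"
  shows "inversions w \<subseteq> {1..n} \<times> {1..n}"
proof
  fix p assume "p \<in> inversions w"
  then obtain a b where p: "p = (a, b)" "a < b" "w b < w a"
    by (auto simp: inversions_def)
  have fixed: "w i = i" if "i = 0 \<or> n < i" for i
    using that permutes_not_in [OF assms(1)] by fastforce
  have le: "w i \<le> n" if "i \<le> n" for i
  proof (cases "i = 0")
    case False
    then show ?thesis using permutes_in_image [OF assms(1), of i] that by auto
  qed (simp add: fixed)
  have "a \<noteq> 0" using p fixed [of 0] by (metis not_less0)
  moreover have "b \<le> n"
    using p fixed [of b] fixed [of a] le [of a] by (cases "a \<le> n"; cases "b \<le> n") auto
  ultimately show "p \<in> {1..n} \<times> {1..n}"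
    using p by auto
qed

lemma inversions_id [simp]: "inversions (\<lambda>a. a) = {}"
  by (auto simp: inversions_def)

lemma finite_inversions: "w permutes {1..n} \<Longrightarrow> finite (inversions w)"
  by (rule finite_subset [OF inversions_subset]) auto

text \<open>\<open>adj j\<close> preserves the order of every pair a < b except
  \<open>(j, Suc j)\<close>.\<close>

lemma inversions_comp_adj:
  assumes "w j < w (Suc j)"
  shows "inversions (w \<circ> adj j) = insert (j, Suc j) (map_prod (adj j) (adj j) ` inversions w)"
proof -
  have adj_less: "adj j a < adj j b" if "a < b" "(a, b) \<noteq> (j, Suc j)" for a b
    using that by (auto simp: transpose_def)
  show ?thesis
  proof (intro set_eqI iffI)
    fix p assume "p \<in> inversions (w \<circ> adj j)"
    then obtain a b where p: "p = (a, b)" "a < b" "w (adj j b) < w (adj j a)"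
      by (auto simp: inversions_def)
    show "p \<in> insert (j, Suc j) (map_prod (adj j) (adj j) ` inversions w)"
    proof (cases "p = (j, Suc j)")
      case False
      then have "(adj j a, adj j b) \<in> inversions w"
        using p adj_less by (auto simp: inversions_def)
      then have "map_prod (adj j) (adj j) (adj j a, adj j b) \<in> map_prod (adj j) (adj j) ` inversions w"
        by (rule imageI)
      then show ?thesis using p by simp
    qed simp
  next
    fix p assume "p \<in> insert (j, Suc j) (map_prod (adj j) (adj j) ` inversions w)"
    then consider "p = (j, Suc j)" | a b where "p = (adj j a, adj j b)" "a < b" "w b < w a"
      by (auto simp: inversions_def)
    then show "p \<in> inversions (w \<circ> adj j)"
    proof cases
      case 2
      then have "(a, b) \<noteq> (j, Suc j)" using assms by auto
      then show ?thesis using 2 adj_less by (auto simp: inversions_def)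
    qed (use assms in \<open>simp add: inversions_def\<close>)
  qed
qed

lemma card_inversions_ascent:
  assumes "w j < w (Suc j)" "finite (inversions w)"
  shows "card (inversions (w \<circ> adj j)) = Suc (card (inversions w))"
proof -
  have inj: "inj (map_prod (adj j) (adj j))"
    by (intro prod.inj_map) auto
  have "(j, Suc j) \<notin> map_prod (adj j) (adj j) ` inversions w"
  proof
    assume "(j, Suc j) \<in> map_prod (adj j) (adj j) ` inversions w"
    then obtain a b where "a < b" "j = adj j a" "Suc j = adj j b"
      by (auto simp: inversions_def)
    then have "a = Suc j" "b = j" by (metis adj_adj adj_simps(1,2))+
    then show False using \<open>a < b\<close> by simp
  qed
  then show ?thesis
    unfolding inversions_comp_adj [of w j, OF assms(1)]
    using assms(2) by (simp add: card_image inj_on_subset [OF inj])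
qed

lemma card_inversions_descent:
  assumes "w (Suc j) < w j" "finite (inversions (w \<circ> adj j))"
  shows "card (inversions w) = Suc (card (inversions (w \<circ> adj j)))"
  using card_inversions_ascent [of "w \<circ> adj j" j] assms by simp

lemma chain_length:
  assumes "w permutes {1..n}" "chain w js"
  shows "length js = card (inversions w)"
  using assms
proof (induction js arbitrary: w)
  case Nil
  then show ?case by simp
next
  case (Cons j js)
  then have "w \<circ> adj j permutes {1..n}"
    using descent_in_range [of w n j] permutes_comp_adj [of w n j] by auto
  then show ?case
    using Cons card_inversions_descent [of w j] by (auto simp: finite_inversions)
qed

text \<open>The permutations met when the staircase word sorts the longest permutation: the first
  \<open>k - 1\<close> entries are still untouched, and the entry \<open>n - k + 1\<close> has reached position \<open>m\<close> on its way
  to the right end.\<close>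

definition sorting_state :: "nat \<Rightarrow> nat \<Rightarrow> nat \<Rightarrow> nat \<Rightarrow> nat" where
  "sorting_state n k m i = (if i = 0 \<or> n < i then i else if i < k then n + 1 - i
    else if i < m then i - k + 1 else if i = m then n - k + 1 else i - k)"

lemma sorting_state_comp_adj:
  assumes "1 \<le> k" "k \<le> m" "m < n"
  shows "sorting_state n k m \<circ> adj m = sorting_state n k (Suc m)"
proof
  fix i
  consider "i = m" | "i = Suc m" | "i \<noteq> m" "i \<noteq> Suc m" by blast
  then show "(sorting_state n k m \<circ> adj m) i = sorting_state n k (Suc m) i"
    by cases (use assms in \<open>auto simp: sorting_state_def\<close>)
qed

lemma chain_sorting_state_row:
  assumes "1 \<le> k" "k \<le> m" "m \<le> n" "chain (sorting_state n k n) js"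
  shows "chain (sorting_state n k m) ([m..<n] @ js)"
  using assms(3)
proof (induction rule: inc_induct)
  case (step l)
  have "sorting_state n k l (Suc l) < sorting_state n k l l"
    using step assms by (auto simp: sorting_state_def)
  moreover have "sorting_state n k l \<circ> adj l = sorting_state n k (Suc l)"
    using step assms by (intro sorting_state_comp_adj) auto
  ultimately show ?case
    using step by (simp add: upt_conv_Cons)
qed (use assms in simp)

lemma chain_sorting_state: "k \<le> n \<Longrightarrow> chain (sorting_state n k k) (map fst (staircase n k))"
proof (induction k)
  case 0
  then show ?case by (auto simp: sorting_state_def fun_eq_iff)
next
  case (Suc k)
  have "sorting_state n (Suc k) n = sorting_state n k k"
    using Suc.prems by (auto simp: sorting_state_def fun_eq_iff)
  then show ?case
    using Suc chain_sorting_state_row [of "Suc k" "Suc k" n "map fst (staircase n k)"]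
    by (simp add: comp_def del: upt_Suc)
qed

lemma chain_longest_perm: "chain (longest_perm n) (map fst (staircase n n))"
proof -
  have "longest_perm n = sorting_state n n n"
    by (auto simp: sorting_state_def longest_perm_def fun_eq_iff)
  then show ?thesis using chain_sorting_state [of n n] by simp
qed

lemma longest_perm_permutes: "longest_perm n permutes {1..n}"
proof (rule bij_imp_permutes)
  show "bij_betw (longest_perm n) {1..n} {1..n}"
    by (rule bij_betw_byWitness [where f' = "longest_perm n"]) (auto simp: longest_perm_def)
qed (auto simp: longest_perm_def)

lemma weight_append: "weight (ps @ qs) = weight ps * weight qs"
  by (simp add: weight_def)

lemma weight_staircase: "weight (staircase n k) = (\<Prod>i = 1..k. X i ^ (n - i))"
proof (induction k)
  case (Suc k)
  have "weight (map (\<lambda>j. (j, a)) xs) = X a ^ length xs" for a and xs :: "nat list"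
    by (induction xs) auto
  then show ?case
    using Suc by (simp add: weight_append mult.commute del: upt_Suc)
qed simp

text \<open>The full staircase word is a chain, and all chains of a permutation have the same
  length, so no proper sublist of the staircase contributes.\<close>

lemma bjs_longest_perm: "bjs (longest_perm n) = (\<Prod>i = 1..n. X i ^ (n - i))"
proof -
  have "compatible_pairs (longest_perm n) = {staircase n n}"
  proof (intro equalityI subsetI)
    fix ps assume "ps \<in> compatible_pairs (longest_perm n)"
    then have ps: "sorted_wrt prec ps" "set ps \<subseteq> set (staircase n n)" "chain (longest_perm n) (map fst ps)"
      unfolding compatible_pairs_eq [OF longest_perm_permutes] subseqs_sorted_prec [OF sorted_staircase]
      by auto
    then have "length ps = length (staircase n n)"
      using chain_length [OF longest_perm_permutes ps(3)]
        chain_length [OF longest_perm_permutes chain_longest_perm] by simp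
    then have "card (set ps) = card (set (staircase n n))"
      using ps(1) by (simp add: distinct_card sorted_prec_distinct sorted_staircase)
    then have "set ps = set (staircase n n)"
      using ps(2) by (simp add: card_subset_eq)
    then show "ps \<in> {staircase n n}"
      using sorted_prec_unique [OF ps(1) sorted_staircase] by simp
  next
    fix ps assume "ps \<in> {staircase n n}"
    then show "ps \<in> compatible_pairs (longest_perm n)"
      unfolding compatible_pairs_eq [OF longest_perm_permutes] subseqs_sorted_prec [OF sorted_staircase]
      using chain_longest_perm sorted_staircase by auto
  qed
  then show ?thesis by (simp add: bjs_def weight_staircase)
qed

lemma is_schubert_imp_eq_bjs:
  assumes "is_schubert w f"
  shows "(\<exists>n. w permutes {1..n}) \<and> f = bjs w"
  using assms
proof induction
  case (longest n)
  then show ?case using bjs_longest_perm longest_perm_permutes by auto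
next
  case (descend w f i)
  then obtain n where n: "w permutes {1..n}" by auto
  \<comment> \<open>Enlarging n makes \<open>i\<close> one of the generators of the truncated
    product; \<open>bjs\<close> stays the same.\<close>
  have "w permutes {1..max n (Suc i)}"
    by (rule permutes_subset [OF n]) auto
  then have *: "w permutes {1..max n (Suc i)}" "w \<circ> adj i permutes {1..max n (Suc i)}"
    using descend permutes_comp_adj [of w "max n (Suc i)" i] by auto
  have "divided_diff i (bjs w) = bjs (w \<circ> adj i)"
    unfolding bjs_eq_rows_op [OF *(1)] bjs_eq_rows_op [OF *(2)]
    by (rule divided_diff_rows_op) (use descend in auto)
  then show ?case
    using descend *(2) by blast
qed

text \<open>The sum \<open>w i + i\<close> never increases with i; it is at most n + 1 at the left
  end and at least n + 1 at the right end.\<close>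

lemma decreasing_eq_longest_perm:
  assumes "w permutes {1..n}" and dec: "\<And>i. 1 \<le> i \<Longrightarrow> i < n \<Longrightarrow> w (Suc i) < w i"
  shows "w = longest_perm n"
proof
  fix i
  have range: "1 \<le> w i \<and> w i \<le> n" if "1 \<le> i" "i \<le> n" for i
    using permutes_in_image [OF assms(1), of i] that by auto
  show "w i = longest_perm n i"
  proof (cases "1 \<le> i \<and> i \<le> n")
    case True
    then have "1 \<le> i" "i \<le> n" by auto
    have "w i + i \<le> n + 1"
      using \<open>1 \<le> i\<close> \<open>i \<le> n\<close>
    proof (induction i rule: dec_induct)
      case base
      then show ?case using range [of 1] by simp
    next
      case (step m)
      then show ?case using dec [of m] by simp
    qed
    moreover have "n + 1 \<le> w i + i"
      using \<open>i \<le> n\<close> \<open>1 \<le> i\<close>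
    proof (induction i rule: inc_induct)
      case base
      then show ?case using range [of n] by simp
    next
      case (step m)
      then show ?case using dec [of m] by simp
    qed
    ultimately show ?thesis
      using True by (simp add: longest_perm_def)
  next
    case False
    then show ?thesis
      using permutes_not_in [OF assms(1), of i] by (auto simp: longest_perm_def)
  qed
qed

text \<open>Multiplying at ascents leads upwards to the longest permutation, and
  \<open>descend\<close> retraces the path. Inversions lie in a square of side n, so
  \<open>n * n\<close> minus their number decreases at each ascent.\<close>

lemma ex_is_schubert:
  assumes "w permutes {1..n}"
  shows "\<exists>f. is_schubert w f"
  using assms
proof (induction "n * n - card (inversions w)" arbitrary: w rule: less_induct)
  case less
  show ?case
  proof (cases "\<exists>i\<ge>1. i < n \<and> w i < w (Suc i)")
    case True
    then obtain i where i: "1 \<le> i" "i < n" "w i < w (Suc i)" by auto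
    let ?v = "w \<circ> adj i"
    have v: "?v permutes {1..n}"
      using permutes_comp_adj [OF less.prems i(1,2)] .
    have "card (inversions ?v) \<le> card ({1..n} \<times> {1..n})"
      by (rule card_mono [OF _ inversions_subset [OF v]]) auto
    then have "card (inversions ?v) \<le> n * n"
      by (simp add: card_cartesian_product)
    then have "\<exists>f. is_schubert ?v f"
      using card_inversions_ascent [of w i] i finite_inversions [OF less.prems] v less.hyps [of ?v] by simp
    then obtain f where "is_schubert ?v f" by blast
    then have "is_schubert (?v \<circ> adj i) (divided_diff i f)"
      using i by (intro is_schubert.descend) auto
    then show ?thesis by auto
  next
    case False
    have "w = longest_perm n"
    proof (rule decreasing_eq_longest_perm [OF less.prems])
      fix i assume "1 \<le> i" "i < n"
      moreover have "w i \<noteq> w (Suc i)"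
        using inj_eq [OF permutes_inj [OF less.prems], of i "Suc i"] by simp
      ultimately show "w (Suc i) < w i" using False by force
    qed
    then show ?thesis using is_schubert.longest by auto
  qed
qed

lemma schubert_eq_bjs: "w permutes {1..n} \<Longrightarrow> schubert w = bjs w"
  unfolding schubert_def
  using ex_is_schubert is_schubert_imp_eq_bjs by (intro the_equality) auto

section \<open>Chains are the reduced words of the inverse\<close>

lemma ex_chain:
  assumes "w permutes {1..n}"
  shows "\<exists>js. chain w js"
  using assms
proof (induction "card (inversions w)" arbitrary: w rule: less_induct)
  case less
  show ?case
  proof (cases "\<exists>j. w (Suc j) < w j")
    case True
    then obtain j where j: "w (Suc j) < w j" by auto
    then have "w \<circ> adj j permutes {1..n}"
      using less.prems descent_in_range permutes_comp_adj by blast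
    then have "\<exists>js. chain (w \<circ> adj j) js"
      using less.hyps card_inversions_descent [of w j] j by (simp add: finite_inversions)
    then show ?thesis using j by (metis chain.simps(2))
  next
    case False
    have "w j < w (Suc j)" for j
      using False permutes_inj [OF less.prems] by (metis injD n_not_Suc_n not_less_iff_gr_or_eq)
    then have mono: "strict_mono w" by (simp add: strict_mono_Suc_iff)
    have "strict_mono (inv w)"
      using strict_mono_inv [OF mono] permutes_surj [OF less.prems] permutes_inverses [OF less.prems] by blast
    then have "w i \<le> i" "i \<le> w i" for i
      using strict_mono_imp_increasing [of "inv w" i] strict_mono_imp_increasing [OF mono, of i]
        strict_mono_less_eq [OF mono, of i "inv w i"] permutes_inverses [OF less.prems] by auto
    then have "w = id" by (auto simp: fun_eq_iff intro: antisym)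
    then show ?thesis using chain.simps(1) by blast
  qed
qed

lemma word_perm_simps [simp]:
  "word_perm [] = id" "word_perm (j # js) = adj j \<circ> word_perm js"
  by (simp_all add: word_perm_def)

lemma chain_word_perm: "chain w js \<Longrightarrow> w \<circ> word_perm js = id"
  by (induction js arbitrary: w) (simp_all add: o_assoc)

text \<open>Each letter changes the number of inversions by exactly one, so the identity is reached
  in the minimal number of steps only if every step is a descent. Letters may exceed n, which
  therefore varies in the induction.\<close>

lemma word_perm_length_ge:
  assumes "w permutes {1..n}" "set js \<subseteq> {1..}" "w \<circ> word_perm js = id"
  shows "card (inversions w) \<le> length js \<and> (length js = card (inversions w) \<longrightarrow> chain w js)"
  using assms
proof (induction js arbitrary: w n)
  case Nil
  then show ?case by (simp add: id_def)
next
  case (Cons j js)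
  have *: "w permutes {1..max n (Suc j)}"
    by (rule permutes_subset [OF Cons.prems(1)]) auto
  then have v: "w \<circ> adj j permutes {1..max n (Suc j)}"
    using permutes_comp_adj Cons.prems(2) by auto
  have "w \<circ> adj j \<circ> word_perm js = id"
    using Cons.prems(3) by (simp only: word_perm_simps o_assoc)
  moreover have "set js \<subseteq> {1..}"
    using Cons.prems(2) by simp
  ultimately have IH: "card (inversions (w \<circ> adj j)) \<le> length js"
      "length js = card (inversions (w \<circ> adj j)) \<Longrightarrow> chain (w \<circ> adj j) js"
    using Cons.IH [OF v] by blast+
  have "w j \<noteq> w (Suc j)"
    using inj_eq [OF permutes_inj [OF *], of j "Suc j"] by simp
  then consider "w j < w (Suc j)" | "w (Suc j) < w j" by linarith
  then show ?case
  proof cases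
    case 1
    then show ?thesis
      using card_inversions_ascent [OF 1 finite_inversions [OF *]] IH by simp
  next
    case 2
    then show ?thesis
      using card_inversions_descent [OF 2 finite_inversions [OF v]] IH by simp
  qed
qed

lemma reduced_words_inv:
  assumes "w permutes {1..n}"
  shows "reduced_words (inv w) = {js. chain w js}"
proof -
  have eq: "word_perm js = inv w \<longleftrightarrow> w \<circ> word_perm js = id" for js
    using permutes_inv_o [OF assms] by (metis comp_assoc comp_id id_comp)
  have chainD: "js \<in> words_for (inv w)" "length js = card (inversions w)" if "chain w js" for js
    using that chain_word_perm [OF that] chain_in_range [OF assms that] chain_length [OF assms that] eq
    by (auto simp: words_for_def)
  have "perm_length (inv w) = card (inversions w)"
    unfolding perm_length_def
  proof (rule Least_equality)
    show "\<exists>js\<in>words_for (inv w). length js = card (inversions w)"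
      using ex_chain [OF assms] chainD by blast
  qed (use word_perm_length_ge [OF assms] eq in \<open>auto simp: words_for_def\<close>)
  then show ?thesis
    using chainD word_perm_length_ge [OF assms] eq
    by (auto simp: reduced_words_def words_for_def)
qed

lemma finite_chains:
  assumes "w permutes {1..n}"
  shows "finite {js. chain w js}"
proof (rule finite_subset)
  show "{js. chain w js} \<subseteq> {js. set js \<subseteq> {1..<n} \<and> length js = card (inversions w)}"
    using chain_in_range [OF assms] chain_length [OF assms] by auto
qed (simp add: finite_lists_length_eq)

lemma permutes_finite_supportD:
  fixes w :: "nat \<Rightarrow> nat"
  assumes "w permutes {1..}" "finite {i. w i \<noteq> i}"
  shows "\<exists>n. w permutes {1..n}"
proof -
  obtain n where n: "\<forall>i\<in>{i. w i \<noteq> i}. i \<le> n"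
    using assms(2) finite_nat_set_iff_bounded_le by blast
  have "w permutes {1..n}"
    by (rule permutes_superset [OF assms(1)]) (use n in force)
  then show ?thesis ..
qed

lemma chain_swap:
  assumes "Suc i < j \<or> Suc j < i"
  shows "chain w (xs @ i # j # ys) \<longleftrightarrow> chain w (xs @ j # i # ys)"
proof (induction xs arbitrary: w)
  case Nil
  have "w \<circ> adj i \<circ> adj j = w \<circ> adj j \<circ> adj i"
    using assms adj_commute by metis
  then show ?case using assms by auto
qed simp

section \<open>Labelled forests and insertion\<close>

lemma canon_simps [simp]:
  "canon Leaf = {}" "canon (Node l x r) = insert (fst x) (canon l \<union> canon r)"
  by (auto simp: canon_def)

text \<open>Half-open intervals give \<open>Leaf\<close> an empty interval at a definite position,
  so missing children need no separate case.\<close>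

fun spans :: "ltree \<Rightarrow> int \<Rightarrow> int \<Rightarrow> bool" where
  "spans Leaf lo hi \<longleftrightarrow> lo = hi"
| "spans (Node l (c, a) r) lo hi \<longleftrightarrow> spans l lo c \<and> spans r (c + 1) hi"

fun lbs :: "ltree \<Rightarrow> bool" where
  "lbs Leaf \<longleftrightarrow> True"
| "lbs (Node l (c, a) r) \<longleftrightarrow> lbs l \<and> lbs r \<and> (l \<noteq> Leaf \<longrightarrow> snd (value l) < a)
    \<and> (r \<noteq> Leaf \<longrightarrow> a < snd (value r)) \<and> fst a \<in> canon (Node l (c, a) r)"

definition nodes :: "ltree set \<Rightarrow> (int \<times> letter) set" where
  "nodes T = (\<Union>t\<in>T. set_tree t)"

text \<open>The invariant of insertion. Distance at least 2 between trees says that their intervals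
  are maximal blocks of the support.\<close>

definition tableau :: "ltree set \<Rightarrow> bool" where
  "tableau T \<longleftrightarrow> finite T \<and> (\<forall>t\<in>T. t \<noteq> Leaf \<and> lbs t \<and> (\<exists>lo hi. spans t lo hi))
    \<and> (\<forall>t\<in>T. \<forall>t'\<in>T. t \<noteq> t' \<longrightarrow> (\<forall>i\<in>canon t. \<forall>j\<in>canon t'. 2 \<le> \<bar>i - j\<bar>))
    \<and> inj_on snd (nodes T)"

lemma spans_canon: "spans t lo hi \<Longrightarrow> lo \<le> hi \<and> canon t = {lo..<hi}"
proof (induction t lo hi rule: spans.induct)
  case (2 l c a r lo hi)
  then have "canon l = {lo..<c}" "canon r = {c + 1..<hi}" "lo \<le> c" "c + 1 \<le> hi"
    by auto
  then show ?case by auto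
qed auto

lemma spans_le: "spans t lo hi \<Longrightarrow> lo \<le> hi"
  using spans_canon by blast

lemma inorder_spans: "spans t lo hi \<Longrightarrow> inorder (map_tree fst t) = [lo..hi - 1]"
proof (induction t lo hi rule: spans.induct)
  case (2 l c a r lo hi)
  then have "lo \<le> c" "c \<le> hi - 1"
    using spans_le [of l lo c] spans_le [of r "c + 1" hi] by auto
  then have "[lo..hi - 1] = [lo..c - 1] @ c # [c + 1..hi - 1]"
    by (rule upto_split3)
  then show ?case using 2 by simp
qed auto

lemma leftmost_spans: "spans t lo hi \<Longrightarrow> t \<noteq> Leaf \<Longrightarrow> leftmost (map_tree fst t) = lo"
  by (induction t lo hi rule: spans.induct) auto

lemma inj_on_fst_spans: "spans t lo hi \<Longrightarrow> inj_on fst (set_tree t)"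
proof (induction t lo hi rule: spans.induct)
  case (2 l c a r lo hi)
  have "canon l = {lo..<c}" "canon r = {c + 1..<hi}"
    using 2 spans_canon by auto
  then have "fst ` set_tree l = {lo..<c}" "fst ` set_tree r = {c + 1..<hi}"
    by (auto simp: canon_def)
  then have "c \<notin> fst ` (set_tree l \<union> set_tree r)" "fst ` set_tree l \<inter> fst ` set_tree r = {}"
    by (auto simp only: image_Un atLeastLessThan_iff)
  moreover from this(2) have "inj_on fst (set_tree l \<union> set_tree r)"
    using 2 unfolding inj_on_Un by fastforce
  ultimately show ?case
    by (simp add: inj_on_insert) blast
qed auto

lemma tree_at_eq:
  assumes "tableau T" "t \<in> T" "i \<in> canon t"
  shows "tree_at T i = t"
proof -
  have "s = t" if "s \<in> T" "i \<in> canon s" for s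
  proof (rule ccontr)
    assume "s \<noteq> t"
    then have "2 \<le> \<bar>i - i\<bar>"
      using assms that unfolding tableau_def by blast
    then show False by simp
  qed
  then have "(THE s. s \<in> T \<and> i \<in> canon s) = t"
    using assms by (intro the_equality) blast+
  then show ?thesis
    unfolding tree_at_def using assms by auto
qed

lemma tree_at_cases:
  assumes "tableau T"
  obtains "tree_at T i = Leaf" "\<And>t. t \<in> T \<Longrightarrow> i \<notin> canon t"
    | "tree_at T i \<in> T" "i \<in> canon (tree_at T i)"
proof (cases "\<exists>t\<in>T. i \<in> canon t")
  case True
  then show ?thesis using tree_at_eq [OF assms] that(2) by metis
next
  case False
  then show ?thesis using that(1) by (auto simp: tree_at_def)
qed

lemma lbs_value: "lbs t \<Longrightarrow> t \<noteq> Leaf \<Longrightarrow> fst (snd (value t)) \<in> canon t"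
  by (cases t rule: lbs.cases) auto

lemma canon_less:
  assumes "tableau T" "t \<in> T" "i \<in> canon t" "c \<notin> canon t" "j \<in> canon t"
  shows "i < c \<longleftrightarrow> j < c"
proof -
  obtain lo hi where "spans t lo hi" using assms(1,2) by (auto simp: tableau_def)
  then show ?thesis using spans_canon assms(3-) by fastforce
qed

text \<open>The value of a root letter lies in its own block, hence on the same side of
  \<open>c\<close> as the whole block.\<close>

lemma value_less:
  assumes "tableau T" "t \<in> T" "i \<in> canon t" "i < c" "c \<notin> canon t" "c \<le> fst a"
  shows "snd (value t) < a"
proof -
  have "fst (snd (value t)) \<in> canon t"
    using assms lbs_value by (auto simp: tableau_def)
  then have "fst (snd (value t)) < c"
    using canon_less [OF assms(1-3,5)] assms(4) by blast
  then show ?thesis using assms(6) by (auto simp: less_prod_def')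
qed

lemma value_greater:
  assumes "tableau T" "t \<in> T" "i \<in> canon t" "c < i" "c \<notin> canon t" "fst a \<le> c"
  shows "a < snd (value t)"
proof -
  have v: "fst (snd (value t)) \<in> canon t"
    using assms lbs_value by (auto simp: tableau_def)
  then have "\<not> fst (snd (value t)) < c"
    using canon_less [OF assms(1-3,5)] assms(4) by (meson less_asym)
  then have "c < fst (snd (value t))"
    using v assms(5) by (metis linorder_neqE)
  then show ?thesis using assms(6) by (auto simp: less_prod_def')
qed

text \<open>The conditions under which adding a root with canonical label \<open>c\<close> and letter \<open>a\<close> keeps a
  tableau a tableau; all three cases of the insertion satisfy them.\<close>

definition attachable :: "ltree set \<Rightarrow> int \<Rightarrow> letter \<Rightarrow> bool" where
  "attachable T c a \<longleftrightarrow> (\<forall>t\<in>T. c \<notin> canon t)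
    \<and> (tree_at T (c - 1) \<noteq> Leaf \<longrightarrow> snd (value (tree_at T (c - 1))) < a)
    \<and> (tree_at T (c + 1) \<noteq> Leaf \<longrightarrow> a < snd (value (tree_at T (c + 1))))
    \<and> fst a \<in> insert c (canon (tree_at T (c - 1)) \<union> canon (tree_at T (c + 1)))"

lemma spans_tree_at_left:
  assumes "tableau T" "\<forall>t\<in>T. c \<notin> canon t"
  shows "\<exists>lo. spans (tree_at T (c - 1)) lo c"
  using assms(1)
proof (cases rule: tree_at_cases [where i = "c - 1"])
  case 2
  then obtain lo hi where s: "spans (tree_at T (c - 1)) lo hi"
    using assms by (auto simp: tableau_def)
  then have "hi = c"
    using 2 assms(2) spans_canon [OF s] by force
  then show ?thesis using s by auto
qed auto

lemma spans_tree_at_right: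
  assumes "tableau T" "\<forall>t\<in>T. c \<notin> canon t"
  shows "\<exists>hi. spans (tree_at T (c + 1)) (c + 1) hi"
  using assms(1)
proof (cases rule: tree_at_cases [where i = "c + 1"])
  case 2
  then obtain lo hi where s: "spans (tree_at T (c + 1)) lo hi"
    using assms by (auto simp: tableau_def)
  then have "lo = c + 1"
    using 2 assms(2) spans_canon [OF s] by force
  then show ?thesis using s by auto
qed auto

lemma tree_at_props:
  assumes "tableau T"
  shows "tree_at T i = Leaf \<or> tree_at T i \<in> T" "lbs (tree_at T i)"
  using assms by (cases rule: tree_at_cases [where i = i]; auto simp: tableau_def)+

lemma nodes_add_root:
  assumes "tableau T"
  shows "nodes (add_root c a T) = insert (c, a) (nodes T)"
  using tree_at_props(1) [OF assms, of "c - 1"] tree_at_props(1) [OF assms, of "c + 1"]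
  unfolding nodes_def add_root_def Let_def by auto

lemma tableau_add_root:
  assumes T: "tableau T" and "attachable T c a" "a \<notin> snd ` nodes T"
  shows "tableau (add_root c a T)"
proof -
  let ?L = "tree_at T (c - 1)" and ?R = "tree_at T (c + 1)"
  let ?t = "Node ?L (c, a) ?R"
  have c: "\<forall>t\<in>T. c \<notin> canon t" using assms(2) by (simp add: attachable_def)
  have eq: "add_root c a T = insert ?t (T - {?L, ?R})"
    by (simp add: add_root_def Let_def)
  have lbs: "lbs ?t"
    using assms(2) tree_at_props(2) [OF T] by (simp add: attachable_def)
  have spans: "\<exists>lo hi. spans ?t lo hi"
    using spans_tree_at_left [OF T c] spans_tree_at_right [OF T c] by auto
  \<comment> \<open>A third tree contains none of \<open>c - 1\<close>, \<open>c\<close>,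
    \<open>c + 1\<close>: trees at the outer two are unique, and \<open>c\<close> is free.\<close>
  have sep: "2 \<le> \<bar>i - j\<bar>" if t: "t \<in> T" "t \<noteq> ?L" "t \<noteq> ?R" and "i \<in> canon ?t" "j \<in> canon t" for i j t
  proof -
    have "j \<noteq> c - 1" "j \<noteq> c + 1" "j \<noteq> c"
      using t \<open>j \<in> canon t\<close> tree_at_eq [OF T t(1)] c by auto
    then have "2 \<le> \<bar>c - j\<bar>" by linarith
    moreover have "2 \<le> \<bar>i - j\<bar>" if "s = ?L \<or> s = ?R" "i \<in> canon s" for s
    proof -
      have "s \<in> T" using that tree_at_props(1) [OF T] by (metis canon_simps(1) empty_iff)
      then show ?thesis
        using T t that \<open>j \<in> canon t\<close> unfolding tableau_def by metis
    qed
    ultimately show ?thesis using \<open>i \<in> canon ?t\<close> by auto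
  qed
  have "finite (add_root c a T)" using T by (simp add: eq tableau_def)
  moreover have "u \<noteq> Leaf \<and> lbs u \<and> (\<exists>lo hi. spans u lo hi)" if "u \<in> add_root c a T" for u
  proof (cases "u = ?t")
    case False
    then have "u \<in> T" using that by (simp add: eq)
    then show ?thesis using T by (simp add: tableau_def)
  qed (use lbs spans in blast)
  moreover have "2 \<le> \<bar>i - j\<bar>" if uv: "u \<in> add_root c a T" "v \<in> add_root c a T" "u \<noteq> v"
      "i \<in> canon u" "j \<in> canon v" for u v i j
  proof -
    have *: "x = ?t \<or> x \<in> T \<and> x \<noteq> ?L \<and> x \<noteq> ?R" if "x \<in> add_root c a T" for x
      using that unfolding eq by blast
    consider "u = ?t" "v \<in> T" "v \<noteq> ?L" "v \<noteq> ?R" | "v = ?t" "u \<in> T" "u \<noteq> ?L" "u \<noteq> ?R" | "u \<in> T" "v \<in> T"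
      using * [OF uv(1)] * [OF uv(2)] uv(3) by metis
    then show ?thesis
    proof cases
      case 1
      then show ?thesis using sep [of v i j] that(4,5) by blast
    next
      case 2
      then show ?thesis using sep [of u j i] uv(4,5) by (metis abs_minus_commute)
    next
      case 3
      then show ?thesis using T that(3-) unfolding tableau_def by blast
    qed
  qed
  moreover have "inj_on snd (nodes (add_root c a T))"
    unfolding nodes_add_root [OF T] using T assms(3)
    by (auto simp: tableau_def inj_on_insert)
  ultimately show ?thesis
    unfolding tableau_def by blast
qed

lemma insert_letter_attachable:
  assumes T: "tableau T" and "a \<notin> snd ` nodes T"
  obtains c where "insert_letter T a = add_root c a T" "attachable T c a"
  using T
proof (cases rule: tree_at_cases [where i = "fst a"])
  case 1
  let ?c = "fst a"
  have "snd (value (tree_at T (?c - 1))) < a" if "tree_at T (?c - 1) \<noteq> Leaf"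
    using T
  proof (cases rule: tree_at_cases [where i = "?c - 1"])
    case 2
    then show ?thesis
      using value_less [OF T 2, of "fst a" a] \<open>\<And>t. t \<in> T \<Longrightarrow> fst a \<notin> canon t\<close> by simp
  qed (use that in simp)
  moreover have "a < snd (value (tree_at T (?c + 1)))" if "tree_at T (?c + 1) \<noteq> Leaf"
    using T
  proof (cases rule: tree_at_cases [where i = "?c + 1"])
    case 2
    then show ?thesis
      using value_greater [OF T 2, of "fst a" a] \<open>\<And>t. t \<in> T \<Longrightarrow> fst a \<notin> canon t\<close> by simp
  qed (use that in simp)
  ultimately have "attachable T ?c a"
    using 1 by (simp add: attachable_def)
  moreover have "insert_letter T a = add_root ?c a T"
    using 1 by (simp add: insert_letter_def)
  ultimately show ?thesis using that by blast
next
  case 2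
  let ?t = "tree_at T (fst a)"
  obtain l c b r where t: "?t = Node l (c, b) r"
    using 2 by (cases ?t) auto
  obtain lo hi where s: "spans ?t lo hi" using 2 T by (auto simp: tableau_def)
  have can: "canon ?t = {lo..<hi}" and "lo < hi"
    using spans_canon [OF s] 2(2) by auto
  \<comment> \<open>Blocks are maximal, so the integers just outside the block of \<open>?t\<close>
    are free.\<close>
  have out: "k \<notin> canon t'" if "t' \<in> T" "k = hi \<or> k = lo - 1" for k t'
  proof
    assume k: "k \<in> canon t'"
    have "t' \<noteq> ?t" using k that(2) can by auto
    then have far: "2 \<le> \<bar>i - k\<bar>" if "i \<in> canon ?t" for i
      using T 2(1) \<open>t' \<in> T\<close> k that unfolding tableau_def by metis
    show False
      using far [of lo] far [of "hi - 1"] can \<open>lo < hi\<close> that(2) by auto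
  qed
  have "(c, b) \<in> nodes T" using 2(1) t by (force simp: nodes_def)
  \<comment> \<open>This turns the else branch of the insertion into \<open>a < b\<close>.\<close>
  then have "b \<noteq> a" using assms(2) by force
  show ?thesis
  proof (cases "b < a")
    case True
    have "Max (canon ?t) = hi - 1"
      unfolding can using \<open>lo < hi\<close> by (intro Max_eqI) auto
    then have "insert_letter T a = add_root hi a T"
      using True t by (simp add: insert_letter_def)
    moreover have L: "tree_at T (hi - 1) = ?t"
      using tree_at_eq [OF T 2(1)] can \<open>lo < hi\<close> by simp
    moreover have "a < snd (value (tree_at T (hi + 1)))" if "tree_at T (hi + 1) \<noteq> Leaf"
      using T
    proof (cases rule: tree_at_cases [where i = "hi + 1"])
      case h: 2
      then show ?thesis
        using value_greater [OF T h, of hi a] out 2(2) can by auto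
    qed (use that in simp)
    ultimately have "attachable T hi a"
      using out True t 2(2) by (auto simp: attachable_def)
    with \<open>insert_letter T a = add_root hi a T\<close> show ?thesis using that by blast
  next
    case False
    then have "a < b" using \<open>b \<noteq> a\<close> by simp
    have "Min (canon ?t) = lo"
      unfolding can using \<open>lo < hi\<close> by (intro Min_eqI) auto
    then have "insert_letter T a = add_root (lo - 1) a T"
      using False t by (simp add: insert_letter_def)
    moreover have L: "tree_at T (lo - 1 + 1) = ?t"
      using tree_at_eq [OF T 2(1)] can \<open>lo < hi\<close> by simp
    moreover have "snd (value (tree_at T (lo - 1 - 1))) < a" if "tree_at T (lo - 1 - 1) \<noteq> Leaf"
      using T
    proof (cases rule: tree_at_cases [where i = "lo - 1 - 1"])
      case h: 2
      then show ?thesis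
        using value_less [OF T h, of "lo - 1" a] out 2(2) can by auto
    qed (use that in simp)
    ultimately have "attachable T (lo - 1) a"
      using out \<open>a < b\<close> t 2(2) by (auto simp: attachable_def)
    with \<open>insert_letter T a = add_root (lo - 1) a T\<close> show ?thesis using that by blast
  qed
qed

section \<open>Undoing an insertion\<close>

definition remove_root :: "ltree \<Rightarrow> ltree set \<Rightarrow> ltree set" where
  "remove_root t T = (T - {t}) \<union> ({left t, right t} - {Leaf})"

text \<open>Any root can be taken as the last one inserted. Whether \<open>fst a\<close> equals
  \<open>c\<close> or lies in the left or the right subtree decides the case of the insertion, and
  the order conditions in \<open>lbs\<close> make the comparison with the child select the old
  position.\<close>

lemma remove_root:
  assumes T: "tableau T" and t: "Node L (c, a) R \<in> T"
  defines "T' \<equiv> remove_root (Node L (c, a) R) T"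
  shows "tableau T'" "nodes T' = nodes T - {(c, a)}" "snd ` nodes T' = snd ` nodes T - {a}"
    "insert_letter T' a = T"
proof -
  let ?t = "Node L (c, a) R"
  have T'_eq: "T' = (T - {?t}) \<union> ({L, R} - {Leaf})"
    by (simp add: T'_def remove_root_def)
  have "\<exists>lo hi. spans ?t lo hi"
    using T t unfolding tableau_def by blast
  then obtain lo hi where s: "spans L lo c" "spans R (c + 1) hi"
    by auto
  have canL: "canon L = {lo..<c}" and canR: "canon R = {c + 1..<hi}" and "lo \<le> c" "c + 1 \<le> hi"
    using spans_canon s by blast+
  have cant: "canon ?t = {lo..<hi}"
    using spans_canon [of ?t lo hi] s by simp
  have lbs: "lbs ?t" using T t by (auto simp: tableau_def)
  have far: "2 \<le> \<bar>i - j\<bar>" if "u \<in> T" "u \<noteq> ?t" "i \<in> canon u" "j \<in> canon ?t" for u i j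
    using T t that unfolding tableau_def by metis
  have sub: "canon L \<subseteq> canon ?t" "canon R \<subseteq> canon ?t" by auto
  have notin: "(c, a) \<notin> set_tree u" if "u \<in> T'" for u
  proof
    assume "(c, a) \<in> set_tree u"
    then have "c \<in> canon u" by (force simp: canon_def)
    then show False
      using that far [of u c c] canL canR by (auto simp: T'_eq)
  qed
  show nodes: "nodes T' = nodes T - {(c, a)}"
  proof -
    have "nodes T = set_tree ?t \<union> nodes (T - {?t})"
      unfolding nodes_def using t by (metis UN_insert insert_Diff)
    moreover have "nodes ({L, R} - {Leaf}) = set_tree L \<union> set_tree R"
      by (cases "L = Leaf"; cases "R = Leaf") (simp_all add: nodes_def insert_Diff_if)
    then have "nodes T' = nodes (T - {?t}) \<union> (set_tree L \<union> set_tree R)"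
      unfolding T'_eq by (simp add: nodes_def)
    ultimately have "nodes T = insert (c, a) (nodes T')" by auto
    moreover have "(c, a) \<notin> nodes T'" using notin by (auto simp: nodes_def)
    ultimately show ?thesis by auto
  qed
  have inj: "inj_on snd (nodes T)" using T by (simp add: tableau_def)
  have "(c, a) \<in> nodes T" using t by (force simp: nodes_def)
  then show "snd ` nodes T' = snd ` nodes T - {a}"
    unfolding nodes using inj_on_image_set_diff [OF inj, of "nodes T" "{(c, a)}"] by simp
  show T': "tableau T'"
  proof -
    have "finite T'" using T by (simp add: T'_eq tableau_def)
    moreover have "u \<noteq> Leaf \<and> lbs u \<and> (\<exists>lo hi. spans u lo hi)" if "u \<in> T'" for u
      using that T lbs s by (auto simp: T'_eq tableau_def)
    moreover have "2 \<le> \<bar>i - j\<bar>" if uv: "u \<in> T'" "v \<in> T'" "u \<noteq> v" "i \<in> canon u" "j \<in> canon v" for u v i j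
    proof -
      have LR: "2 \<le> \<bar>i - j\<bar>" if "i \<in> canon L" "j \<in> canon R" for i j
        using that canL canR by auto
      consider "u \<in> T - {?t}" "v \<in> T - {?t}" | "u \<in> T - {?t}" "v \<in> {L, R}"
        | "u \<in> {L, R}" "v \<in> T - {?t}" | "u \<in> {L, R}" "v \<in> {L, R}"
        using uv(1,2) by (auto simp: T'_eq)
      then show ?thesis
      proof cases
        case 1
        then show ?thesis using T that(3-) by (auto simp: tableau_def)
      next
        case 2
        then show ?thesis using far [of u i j] that(4,5) sub by auto
      next
        case 3
        then have "2 \<le> \<bar>j - i\<bar>" using far [of v j i] that(4,5) sub by auto
        then show ?thesis by (simp add: abs_minus_commute)
      next
        case 4
        then show ?thesis
          using that(3-) LR [of i j] LR [of j i] by (auto simp: abs_minus_commute)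
      qed
    qed
    moreover have "inj_on snd (nodes T')"
      unfolding nodes by (rule inj_on_subset [OF inj]) auto
    ultimately show ?thesis unfolding tableau_def by blast
  qed
  have treeL: "tree_at T' i = L" if "i \<in> canon L" for i
    using that by (intro tree_at_eq [OF T']) (auto simp: T'_eq)
  have treeR: "tree_at T' i = R" if "i \<in> canon R" for i
    using that by (intro tree_at_eq [OF T']) (auto simp: T'_eq)
  have treeN: "tree_at T' i = Leaf" if "i \<notin> canon L" "i \<notin> canon R" "j \<in> canon ?t" "\<bar>i - j\<bar> < 2" for i j
    using T'
  proof (cases rule: tree_at_cases [where i = i])
    case 2
    then show ?thesis
      using far [of "tree_at T' i" i j] that by (auto simp: T'_eq)
  qed
  have c: "c \<in> canon ?t" by simp
  have "tree_at T' (c - 1) = L"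
  proof (cases "L = Leaf")
    case True
    then show ?thesis using treeN [of "c - 1" c] canR by simp
  next
    case False
    then have "canon L \<noteq> {}" by (cases L) auto
    then show ?thesis using treeL canL by simp
  qed
  moreover have "tree_at T' (c + 1) = R"
  proof (cases "R = Leaf")
    case True
    then show ?thesis using treeN [of "c + 1" c] canL by simp
  next
    case False
    then have "canon R \<noteq> {}" by (cases R) auto
    then show ?thesis using treeR canR by simp
  qed
  \<comment> \<open>\<open>add_root\<close> discards every tree equal to \<open>L\<close> or
    \<open>R\<close>, so no other tree of \<open>T\<close> may coincide with one of them.\<close>
  moreover have "u \<notin> T" if "u = L \<or> u = R" for u
  proof
    assume "u \<in> T"
    have "size u < size ?t" using that by auto
    then have "u \<noteq> ?t" by blast
    have "u \<noteq> Leaf" using T \<open>u \<in> T\<close> unfolding tableau_def by blast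
    then obtain i where "i \<in> canon u" by (cases u) auto
    then show False
      using far [OF \<open>u \<in> T\<close> \<open>u \<noteq> ?t\<close>, of i i] that sub by auto
  qed
  ultimately have add: "add_root c a T' = T"
    using t by (auto simp: add_root_def Let_def T'_eq)
  have "fst a \<in> canon ?t" using lbs by simp
  then consider "fst a = c" | "fst a \<in> canon L" | "fst a \<in> canon R" by auto
  then show "insert_letter T' a = T"
  proof cases
    case 1
    then have "tree_at T' (fst a) = Leaf"
      using treeN [of c c] canL canR by simp
    then show ?thesis using add 1 by (simp add: insert_letter_def)
  next
    case 2
    then obtain l k b r where L: "L = Node l (k, b) r" by (cases L) auto
    have "b < a" using lbs L by simp
    moreover have "Max (canon L) + 1 = c"
      unfolding canL using 2 canL by (subst Max_eqI [of _ "c - 1"]) auto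
    ultimately show ?thesis
      using add treeL [OF 2] L by (simp add: insert_letter_def)
  next
    case 3
    then obtain l k b r where R: "R = Node l (k, b) r" by (cases R) auto
    have "\<not> b < a" using lbs R by auto
    moreover have "Min (canon R) - 1 = c"
      unfolding canR using 3 canR by (subst Min_eqI [of _ "c + 1"]) auto
    ultimately show ?thesis
      using add treeR [OF 3] R by (simp add: insert_letter_def)
  qed
qed

section \<open>Equivalence classes as linear extensions\<close>

text \<open>The letters before the first occurrence of \<open>y\<close>; all letters if \<open>y\<close> does not occur.\<close>

abbreviation pre :: "'a list \<Rightarrow> 'a \<Rightarrow> 'a set" where
  "pre W y \<equiv> set (takeWhile (\<lambda>z. z \<noteq> y) W)"

fun ordered :: "letter list \<Rightarrow> ltree \<Rightarrow> bool" where
  "ordered W Leaf \<longleftrightarrow> True"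
| "ordered W (Node l (c, a) r) \<longleftrightarrow> ordered W l \<and> ordered W r
    \<and> (l \<noteq> Leaf \<longrightarrow> snd (value l) \<in> pre W a) \<and> (r \<noteq> Leaf \<longrightarrow> snd (value r) \<in> pre W a)"

definition linear_extension :: "ltree set \<Rightarrow> letter list \<Rightarrow> bool" where
  "linear_extension T W \<longleftrightarrow> distinct W \<and> set W = snd ` nodes T \<and> (\<forall>t\<in>T. ordered W t)"

lemma pre_trans: "x \<in> pre W y \<Longrightarrow> y \<in> pre W z \<Longrightarrow> x \<in> pre W z"
  by (induction W) (auto split: if_splits)

lemma pre_subset: "pre W y \<subseteq> set W"
  using set_takeWhileD by fastforce

lemma pre_append: "y \<in> set W \<Longrightarrow> pre (W @ V) y = pre W y"
  by (induction W) auto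

lemma pre_append_last: "y \<notin> set W \<Longrightarrow> pre (W @ [y]) y = set W"
  by (induction W) auto

lemma pre_delete: "y \<noteq> a \<Longrightarrow> x \<noteq> a \<Longrightarrow> x \<in> pre (U @ a # V) y \<longleftrightarrow> x \<in> pre (U @ V) y"
  by (induction U) auto

lemma ordered_cong:
  assumes "\<And>x y. x \<in> snd ` set_tree t \<Longrightarrow> y \<in> snd ` set_tree t \<Longrightarrow> x \<in> pre W y \<longleftrightarrow> x \<in> pre V y"
  shows "ordered W t \<longleftrightarrow> ordered V t"
  using assms
proof (induction W t rule: ordered.induct)
  case (2 W l c a r)
  have "snd (value l) \<in> pre W a \<longleftrightarrow> snd (value l) \<in> pre V a" if "l \<noteq> Leaf"
    using that by (intro 2) (cases l; auto)+
  moreover have "snd (value r) \<in> pre W a \<longleftrightarrow> snd (value r) \<in> pre V a" if "r \<noteq> Leaf"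
    using that by (intro 2) (cases r; auto)+
  moreover have "ordered W l \<longleftrightarrow> ordered V l"
    by (rule 2(1), rule 2(3)) auto
  moreover have "ordered W r \<longleftrightarrow> ordered V r"
    by (rule 2(2), rule 2(3)) auto
  ultimately show ?case by auto
qed simp

lemma ordered_root:
  assumes "ordered W t" "x \<in> set_tree t"
  shows "x = value t \<or> snd x \<in> pre W (snd (value t))"
  using assms
proof (induction W t rule: ordered.induct)
  case (2 W l c a r)
  have "snd x \<in> pre W a" if "x \<in> set_tree s" "s = l \<or> s = r" for s
  proof -
    have "s \<noteq> Leaf" using that by auto
    then have "snd (value s) \<in> pre W a" using 2(3) that(2) by auto
    moreover have "x = value s \<or> snd x \<in> pre W (snd (value s))"
      using 2 that by auto
    ultimately show ?thesis using pre_trans by metis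
  qed
  then show ?case using 2(4) by auto
qed simp

lemma tableau_empty: "tableau {}"
  by (simp add: tableau_def nodes_def)

lemma nodes_empty [simp]: "nodes {} = {}"
  by (simp add: nodes_def)

lemma P_tableau_snoc: "P_tableau (W @ [a]) = insert_letter (P_tableau W) a"
  by (simp add: P_tableau_def)

lemma P_tableau_Nil [simp]: "P_tableau [] = {}"
  by (simp add: P_tableau_def)

lemma tableau_P_tableau:
  assumes "distinct W"
  shows "tableau (P_tableau W) \<and> linear_extension (P_tableau W) W"
  using assms
proof (induction W rule: rev_induct)
  case Nil
  then show ?case by (simp add: tableau_empty linear_extension_def)
next
  case (snoc a W)
  let ?T = "P_tableau W"
  have T: "tableau ?T" and W: "linear_extension ?T W" and "a \<notin> set W"
    using snoc by auto
  then have set: "set W = snd ` nodes ?T" and ord: "\<forall>t\<in>?T. ordered W t"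
    by (auto simp: linear_extension_def)
  have a: "a \<notin> snd ` nodes ?T" using \<open>a \<notin> set W\<close> set by simp
  obtain c where c: "insert_letter ?T a = add_root c a ?T" "attachable ?T c a"
    using insert_letter_attachable [OF T a] .
  let ?L = "tree_at ?T (c - 1)" and ?R = "tree_at ?T (c + 1)"
  have ordT: "ordered (W @ [a]) t" if "t \<in> ?T" for t
  proof -
    have "pre (W @ [a]) y = pre W y" if "y \<in> snd ` set_tree t" for y
      using that \<open>t \<in> ?T\<close> set by (intro pre_append) (auto simp: nodes_def)
    then have "ordered (W @ [a]) t \<longleftrightarrow> ordered W t"
      by (intro ordered_cong) simp
    then show ?thesis using ord that by blast
  qed
  have child: "s = Leaf \<or> s \<in> ?T \<and> snd (value s) \<in> set W" if "s = ?L \<or> s = ?R" for s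
  proof (cases "s = Leaf")
    case False
    then have "s \<in> ?T" using that tree_at_props(1) [OF T] by metis
    moreover have "value s \<in> set_tree s" using False by (cases s) auto
    ultimately show ?thesis using set by (auto simp: nodes_def)
  qed simp
  have "ordered (W @ [a]) (Node ?L (c, a) ?R)"
    using child [of ?L] child [of ?R] ordT \<open>a \<notin> set W\<close> by (auto simp: pre_append_last)
  then have "\<forall>t\<in>add_root c a ?T. ordered (W @ [a]) t"
    using ordT by (auto simp: add_root_def Let_def)
  moreover have "set (W @ [a]) = snd ` nodes (add_root c a ?T)"
    using set by (simp add: nodes_add_root [OF T])
  ultimately show ?case
    using tableau_add_root [OF T c(2) a] snoc.prems
    unfolding P_tableau_snoc c(1) linear_extension_def by blast
qed

text \<open>A letter that is not at a root precedes the letter of its root, whereas the last letter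
  precedes nothing.\<close>

lemma linear_extension_last_root:
  assumes "linear_extension T (W @ [a])"
  obtains L c R where "Node L (c, a) R \<in> T"
proof -
  have "a \<in> snd ` nodes T" using assms by (auto simp: linear_extension_def)
  then obtain t x where t: "t \<in> T" "x \<in> set_tree t" "snd x = a"
    by (auto simp: nodes_def)
  then have ord: "ordered (W @ [a]) t" using assms by (auto simp: linear_extension_def)
  have "value t \<in> set_tree t" using t(2) by (cases t) auto
  then have "snd (value t) \<in> set (W @ [a])"
    using assms t(1) by (auto simp: linear_extension_def nodes_def)
  have "x = value t"
  proof (rule ccontr)
    assume "x \<noteq> value t"
    then have *: "a \<in> pre (W @ [a]) (snd (value t))" using ordered_root [OF ord t(2)] t(3) by simp
    then have "a \<noteq> snd (value t)" by (auto dest: set_takeWhileD)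
    then have "a \<in> pre W (snd (value t))"
      using * \<open>snd (value t) \<in> set (W @ [a])\<close> by (simp add: pre_append)
    then have "a \<in> set W" using pre_subset by fast
    then show False using assms by (simp add: linear_extension_def)
  qed
  then show ?thesis using t that by (cases t) auto
qed

lemma linear_extension_delete:
  assumes T: "tableau T" and t: "Node L (c, a) R \<in> T" and "linear_extension T (U @ a # V)"
  shows "linear_extension (remove_root (Node L (c, a) R) T) (U @ V)"
proof -
  let ?T' = "remove_root (Node L (c, a) R) T"
  have "distinct (U @ a # V)" "set (U @ a # V) = snd ` nodes T"
      and ord: "\<And>t. t \<in> T \<Longrightarrow> ordered (U @ a # V) t"
    using assms(3) by (auto simp: linear_extension_def)
  then have set: "set (U @ V) = snd ` nodes ?T'" and "distinct (U @ V)"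
    using remove_root(3) [OF T t] by auto
  have "ordered (U @ V) s" if "s \<in> ?T'" for s
  proof -
    have "ordered (U @ a # V) s"
      using that ord ord [OF t] by (auto simp: remove_root_def)
    moreover have "a \<notin> snd ` set_tree s"
    proof -
      have "snd ` set_tree s \<subseteq> snd ` nodes ?T'" using that by (auto simp: nodes_def)
      then show ?thesis using remove_root(3) [OF T t] by auto
    qed
    then have "ordered (U @ a # V) s \<longleftrightarrow> ordered (U @ V) s"
      by (intro ordered_cong pre_delete) auto
    ultimately show ?thesis by simp
  qed
  then show ?thesis
    using set \<open>distinct (U @ V)\<close> by (simp add: linear_extension_def)
qed

text \<open>The last letter sits at a root. Without it the word is a linear extension of the smaller
  tableau, and inserting the letter there restores \<open>T\<close>.\<close>

lemma P_tableau_linear_extension: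
  assumes "tableau T" "linear_extension T W"
  shows "P_tableau W = T"
  using assms
proof (induction W arbitrary: T rule: rev_induct)
  case Nil
  have "T = {}"
  proof (rule ccontr)
    assume "T \<noteq> {}"
    then obtain t where "t \<in> T" by auto
    moreover from this obtain x where "x \<in> set_tree t"
      using Nil.prems(1) by (cases t) (auto simp: tableau_def)
    ultimately show False using Nil.prems(2) by (auto simp: linear_extension_def nodes_def)
  qed
  then show ?case by simp
next
  case (snoc a W)
  obtain L c R where t: "Node L (c, a) R \<in> T"
    using linear_extension_last_root [OF snoc.prems(2)] .
  note rr = remove_root [OF snoc.prems(1) t]
  have "linear_extension (remove_root (Node L (c, a) R) T) (W @ [])"
    by (rule linear_extension_delete [OF snoc.prems(1) t snoc.prems(2)])
  then show ?case
    using snoc.IH [OF rr(1)] rr(4) by (simp add: P_tableau_snoc)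
qed

text \<open>Stated for an invariant \<open>Q\<close> so that the connectedness of the set of linear extensions under
  commutations of distant letters needs no explicit rewriting sequence.\<close>

definition swap_closed :: "(letter list \<Rightarrow> bool) \<Rightarrow> bool" where
  "swap_closed Q \<longleftrightarrow> (\<forall>U a b V. 2 \<le> \<bar>fst a - fst b\<bar> \<longrightarrow> Q (U @ a # b # V) \<longrightarrow> Q (U @ b # a # V))"

lemma swap_closedD:
  "swap_closed Q \<Longrightarrow> 2 \<le> \<bar>fst a - fst b\<bar> \<Longrightarrow> Q (U @ a # b # V) \<Longrightarrow> Q (U @ b # a # V)"
  unfolding swap_closed_def by blast

lemma swap_closed_move:
  assumes "swap_closed Q" "\<forall>x\<in>set V. 2 \<le> \<bar>fst x - fst a\<bar>" "Q (U @ V @ [a])"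
  shows "Q (U @ a # V)"
  using assms(2,3)
proof (induction V arbitrary: U)
  case (Cons x V)
  then have "Q ((U @ [x]) @ a # V)" by (intro Cons.IH) auto
  then show ?case
    using swap_closedD [OF assms(1), of x a U V] Cons.prems by simp
qed simp

lemma lbs_letter: "lbs t \<Longrightarrow> x \<in> set_tree t \<Longrightarrow> fst (snd x) \<in> canon t"
  by (induction t rule: lbs.induct) auto

text \<open>A letter after that of a root belongs to another tree, since within the tree it would
  come earlier. Values of letters lie in the intervals of their trees, which are separated.\<close>

lemma linear_extension_far:
  assumes T: "tableau T" and t: "Node L (c, a) R \<in> T" and W: "linear_extension T (U @ a # V)"
    and "x \<in> set V"
  shows "2 \<le> \<bar>fst x - fst a\<bar>"
proof -
  let ?t = "Node L (c, a) R"
  have dist: "distinct (U @ a # V)" and "x \<in> snd ` nodes T" and ord: "ordered (U @ a # V) ?t"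
    using W \<open>x \<in> set V\<close> t by (auto simp: linear_extension_def)
  then obtain s z where s: "s \<in> T" "z \<in> set_tree s" "snd z = x"
    by (auto simp: nodes_def)
  have "s \<noteq> ?t"
  proof
    assume "s = ?t"
    then consider "z = (c, a)" | "x \<in> pre (U @ a # V) a"
      using ordered_root [OF ord, of z] s by auto
    then show False
    proof cases
      case 1
      then show ?thesis using s dist \<open>x \<in> set V\<close> by auto
    next
      case 2
      have "pre (U @ a # V) a = set U"
        using dist by (induction U) auto
      then show ?thesis using 2 dist \<open>x \<in> set V\<close> by auto
    qed
  qed
  moreover have "fst x \<in> canon s" "fst a \<in> canon ?t"
    using lbs_letter [of s z] lbs_letter [of ?t "(c, a)"] T s t by (auto simp: tableau_def)
  ultimately show ?thesis
    using T s(1) t unfolding tableau_def by metis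
qed

text \<open>Induction for words ending in the last letter of \<open>W\<close> reaches
  \<open>W'\<close> with that letter moved to the end. From there it returns to its place, passing
  only distant letters.\<close>

lemma linear_extensions_connected:
  assumes "tableau T" "linear_extension T W" "linear_extension T W'" "swap_closed Q" "Q W"
  shows "Q W'"
  using assms
proof (induction W arbitrary: T W' Q rule: rev_induct)
  case Nil
  then have "W' = []" by (auto simp: linear_extension_def)
  then show ?case using Nil by simp
next
  case (snoc a W)
  obtain L c R where t: "Node L (c, a) R \<in> T"
    using linear_extension_last_root [OF snoc.prems(2)] .
  let ?T' = "remove_root (Node L (c, a) R) T"
  have "a \<in> set W'" using snoc.prems(2,3) by (auto simp: linear_extension_def)
  then obtain U V where W': "W' = U @ a # V" by (meson split_list)
  have "linear_extension ?T' (W @ [])" "linear_extension ?T' (U @ V)"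
    using linear_extension_delete [OF snoc.prems(1) t] snoc.prems(2,3) W' by blast+
  moreover have "swap_closed (\<lambda>Z. Q (Z @ [a]))"
    using snoc.prems(4) by (simp add: swap_closed_def)
  ultimately have "Q ((U @ V) @ [a])"
    using snoc.IH [of ?T' "U @ V" "\<lambda>Z. Q (Z @ [a])"] remove_root(1) [OF snoc.prems(1) t] snoc.prems(5)
    by simp
  moreover have "\<forall>x\<in>set V. 2 \<le> \<bar>fst x - fst a\<bar>"
    using linear_extension_far [OF snoc.prems(1) t] snoc.prems(3) unfolding W' by blast
  ultimately show ?case
    unfolding W' using swap_closed_move [OF snoc.prems(4)] by simp
qed

section \<open>Numbering the occurrences of each letter\<close>

fun number_from :: "(int \<Rightarrow> nat) \<Rightarrow> int list \<Rightarrow> letter list" where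
  "number_from c [] = []"
| "number_from c (i # is) = (i, Suc (c i)) # number_from (c(i := Suc (c i))) is"

lemma number_from_eq_map:
  "number_from c is = map (\<lambda>p. (is ! p, c (is ! p) + count_list (take (Suc p) is) (is ! p))) [0..<length is]"
proof (induction "is" arbitrary: c)
  case (Cons i "is")
  have "[0..<length (i # is)] = 0 # map Suc [0..<length is]"
    by (simp add: map_Suc_upt upt_conv_Cons del: upt_Suc)
  then show ?case
    by (simp add: Cons comp_def del: upt_Suc)
qed simp

lemma to_injective_eq: "to_injective is = number_from (\<lambda>_. 0) is"
  by (simp add: to_injective_def number_from_eq_map)

lemma map_fst_number_from [simp]: "map fst (number_from c is) = is"
  by (induction "is" arbitrary: c) auto

lemma number_from_gt: "(i, k) \<in> set (number_from c is) \<Longrightarrow> c i < k"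
proof (induction "is" arbitrary: c)
  case (Cons j "is")
  from Cons.prems have "(i, k) = (j, Suc (c j)) \<or> (i, k) \<in> set (number_from (c(j := Suc (c j))) is)"
    by simp
  then consider "(i, k) = (j, Suc (c j))" | "(c(j := Suc (c j))) i < k"
    using Cons.IH by blast
  then show ?case by cases (auto split: if_splits)
qed simp

lemma distinct_number_from: "distinct (number_from c is)"
  by (induction "is" arbitrary: c) (auto dest: number_from_gt)

text \<open>Exchanging two different letters changes no occurrence count.\<close>

lemma number_from_swap:
  assumes "number_from c is = U @ a # b # V" "fst a \<noteq> fst b"
  shows "number_from c (map fst U @ fst b # fst a # map fst V) = U @ b # a # V"
  using assms
proof (induction U arbitrary: c "is")
  case Nil
  then obtain i j ks where "is": "is = i # j # ks"
    by (cases "is"; cases "tl is") auto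
  then have "V = number_from (c(i := Suc (c i), j := Suc (c j))) ks" "a = (i, Suc (c i))" "b = (j, Suc (c j))"
    using Nil by auto
  then show ?case
    using Nil(2) by (simp add: fun_upd_twist)
next
  case (Cons x U)
  then obtain i ks where "is": "is = i # ks" by (cases "is") auto
  then show ?case using Cons by auto
qed

lemma Red_inv:
  assumes "w permutes {1..n}"
  shows "Red (inv w) = (\<lambda>js. number_from (\<lambda>_. 0) (map int js)) ` {js. chain w js}"
  by (simp add: Red_def reduced_words_inv [OF assms] to_injective_eq)

lemma Red_injective:
  assumes "w permutes {1..n}"
  shows "Red (inv w) \<subseteq> injective_words"
proof -
  have "number_from (\<lambda>_. 0) is \<in> injective_words" for "is"
    using number_from_gt [of _ _ "\<lambda>_. 0" "is"]
    by (fastforce simp: injective_words_def distinct_number_from)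
  then show ?thesis by (auto simp: Red_inv [OF assms])
qed

lemma swap_closed_Red:
  assumes "w permutes {1..n}"
  shows "swap_closed (\<lambda>W. W \<in> Red (inv w))"
  unfolding swap_closed_def
proof (intro allI impI)
  fix U V :: "letter list" and a b :: letter
  assume ab: "2 \<le> \<bar>fst a - fst b\<bar>" and "U @ a # b # V \<in> Red (inv w)"
  then obtain js where js: "number_from (\<lambda>_. 0) (map int js) = U @ a # b # V" "chain w js"
    unfolding Red_inv [OF assms] by auto
  from arg_cong [OF js(1), of "map fst"]
  have "map int js = map fst U @ fst a # fst b # map fst V" by simp
  then obtain js1 j1 j2 js2 where split: "js = js1 @ j1 # j2 # js2" "map int js1 = map fst U"
      "int j1 = fst a" "int j2 = fst b" "map int js2 = map fst V"
    by (auto simp: map_eq_append_conv map_eq_Cons_conv)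
  have "Suc j1 < j2 \<or> Suc j2 < j1"
    using ab split(3,4) by linarith
  then have "chain w (js1 @ j2 # j1 # js2)"
    using js(2) split(1) chain_swap by blast
  moreover have "number_from (\<lambda>_. 0) (map int (js1 @ j2 # j1 # js2)) = U @ b # a # V"
    using number_from_swap [OF js(1)] ab split by auto
  ultimately show "U @ b # a # V \<in> Red (inv w)"
    unfolding Red_inv [OF assms] by force
qed

section \<open>Compatible sequences as fillings\<close>

definition compatible_words :: "letter list set \<Rightarrow> (letter \<times> nat) list set" where
  "compatible_words A = {qs. map fst qs \<in> A \<and> sorted_wrt prec qs
    \<and> (\<forall>(a, k)\<in>set qs. 1 \<le> k \<and> int k \<le> fst a)}"

text \<open>By transitivity only neighbours matter. A chain never uses the same generator twice in a
  row, as the first use removes the descent, so neighbours are compared without their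
  numbers.\<close>

lemma sorted_prec_number_from:
  assumes "chain w (map fst ps)"
  shows "sorted_wrt prec (zip (number_from c (map int (map fst ps))) (map snd ps)) \<longleftrightarrow> sorted_wrt prec ps"
  using assms
proof (induction ps arbitrary: w c)
  case (Cons p ps)
  show ?case
  proof (cases ps)
    case (Cons q rs)
    have "fst p \<noteq> fst q"
    proof
      assume "fst p = fst q"
      then show False using Cons.prems Cons by auto
    qed
    then have "prec ((int (fst p), k), snd p) ((int (fst q), m), snd q) \<longleftrightarrow> prec p q" for k m
      by (auto simp: prec_def)
    note prec_iff = this
    define zs where "zs = zip (number_from (c(int (fst p) := Suc (c (int (fst p))))) (map int (map fst ps))) (map snd ps)"
    have "\<exists>m ys. zs = ((int (fst q), m), snd q) # ys"
      unfolding zs_def Cons by simp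
    then obtain m ys where zs: "zs = ((int (fst q), m), snd q) # ys" by blast
    have "sorted_wrt prec zs \<longleftrightarrow> sorted_wrt prec ps"
      unfolding zs_def by (rule Cons.IH [of "w \<circ> adj (fst p)"]) (use Cons.prems in \<open>simp only: list.map chain.simps\<close>)
    moreover have "zip (number_from c (map int (map fst (p # ps)))) (map snd (p # ps))
        = ((int (fst p), Suc (c (int (fst p)))), snd p) # zs"
      by (simp add: zs_def)
    ultimately show ?thesis
      unfolding zs Cons by (simp only: sorted_wrt2 [OF transp_prec] prec_iff)
  qed simp
qed simp

lemma sum_compatible_words_Red:
  assumes "w permutes {1..n}"
  shows "(\<Sum>qs\<in>compatible_words (Red (inv w)). weight qs) = bjs w"
  unfolding bjs_def
proof (rule sum.reindex_bij_witness)
  \<comment> \<open>\<open>?j\<close> forgets the numbers of the letters and \<open>?i\<close>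
    restores them.\<close>
  let ?j = "\<lambda>qs :: (letter \<times> nat) list. map (\<lambda>q. (nat (fst (fst q)), snd q)) qs"
  let ?i = "\<lambda>ps :: (nat \<times> nat) list. zip (number_from (\<lambda>_. 0) (map int (map fst ps))) (map snd ps)"
  have ji: "?j (?i ps) = ps" for ps :: "(nat \<times> nat) list"
  proof -
    have "?j (zip (number_from c (map int (map fst ps))) (map snd ps)) = ps" for c
      by (induction ps arbitrary: c) auto
    then show ?thesis .
  qed
  then show "?j (?i ps) = ps" if "ps \<in> compatible_pairs w" for ps .
  fix qs assume qs: "qs \<in> compatible_words (Red (inv w))"
  then obtain js where js: "chain w js" "map fst qs = number_from (\<lambda>_. 0) (map int js)"
    by (auto simp: compatible_words_def Red_inv [OF assms])
  from arg_cong [OF js(2), of "map fst"] have "map (\<lambda>q. fst (fst q)) qs = map int js"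
    by (simp add: comp_def)
  from arg_cong [OF this, of "map nat"] have js': "map fst (?j qs) = js"
    by (simp add: comp_def)
  show ij: "?i (?j qs) = qs"
    using js(2) unfolding js' by (simp add: comp_def zip_map_fst_snd flip: js(2))
  show "?j qs \<in> compatible_pairs w"
  proof -
    have "sorted_wrt prec (?j qs)"
      using sorted_prec_number_from [of w "?j qs" "\<lambda>_. 0"] qs js(1) js' ij
      by (simp only: compatible_words_def mem_Collect_eq)
    then show ?thesis
      using qs js(1) js' by (auto simp: compatible_pairs_def compatible_words_def simp del: map_map)
  qed
  show "weight (?j qs) = weight qs"
    by (simp add: weight_def comp_def)
next
  let ?i = "\<lambda>ps :: (nat \<times> nat) list. zip (number_from (\<lambda>_. 0) (map int (map fst ps))) (map snd ps)"
  fix ps assume ps: "ps \<in> compatible_pairs w"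
  have len: "length (number_from c is) = length is" for c "is"
    by (metis length_map map_fst_number_from)
  have m1: "map fst (?i ps) = number_from (\<lambda>_. 0) (map int (map fst ps))"
    by (simp add: len)
  have m2: "(\<forall>(a, k)\<in>set (zip (number_from c (map int (map fst ps))) (map snd ps)). 1 \<le> k \<and> int k \<le> fst a)"
    if "\<forall>(j, a)\<in>set ps. 1 \<le> a \<and> a \<le> j" for c
    using that by (induction ps arbitrary: c) auto
  have m3: "number_from (\<lambda>_. 0) (map int (map fst ps)) \<in> Red (inv w)"
    unfolding Red_inv [OF assms] using ps by (auto simp: compatible_pairs_def simp del: map_map)
  show "?i ps \<in> compatible_words (Red (inv w))"
    unfolding compatible_words_def mem_Collect_eq
  proof (intro conjI)
    show "map fst (?i ps) \<in> Red (inv w)" unfolding m1 by (rule m3)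
    show "sorted_wrt prec (?i ps)"
      using sorted_prec_number_from [of w ps "\<lambda>_. 0"] ps by (simp only: compatible_pairs_def mem_Collect_eq)
    show "\<forall>(a, k)\<in>set (?i ps). 1 \<le> k \<and> int k \<le> fst a"
      by (rule m2) (use ps in \<open>simp add: compatible_pairs_def\<close>)
  qed
qed

lemma finite_compatible_words_Red:
  assumes "w permutes {1..n}"
  shows "finite (compatible_words (Red (inv w)))"
proof (rule finite_subset)
  let ?A = "(\<Union>W\<in>Red (inv w). set W) \<times> {..n}"
  have "finite (Red (inv w))"
    unfolding Red_inv [OF assms] using finite_chains [OF assms] by simp
  then have "finite ?A" by simp
  show "finite {qs. set qs \<subseteq> ?A \<and> length qs = card (inversions w)}"
    by (rule finite_lists_length_eq [OF \<open>finite ?A\<close>])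
  show "compatible_words (Red (inv w)) \<subseteq> {qs. set qs \<subseteq> ?A \<and> length qs = card (inversions w)}"
  proof
    fix qs assume qs: "qs \<in> compatible_words (Red (inv w))"
    then obtain js where js: "chain w js" "map fst qs = number_from (\<lambda>_. 0) (map int js)"
      by (auto simp: compatible_words_def Red_inv [OF assms])
    from arg_cong [OF js(2), of "map fst"] have eq: "map (\<lambda>q. fst (fst q)) qs = map int js"
      by (simp add: comp_def)
    from arg_cong [OF eq, of length] have "length qs = card (inversions w)"
      using chain_length [OF assms js(1)] by simp
    moreover have "set qs \<subseteq> ?A"
    proof
      fix q assume q: "q \<in> set qs"
      have "fst (fst q) \<in> set (map (\<lambda>q. fst (fst q)) qs)" using q by auto
      then have "fst (fst q) \<in> int ` set js" unfolding eq by simp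
      then have "fst (fst q) < int n" using chain_in_range [OF assms js(1)] by auto
      then have "snd q \<le> n" using qs q by (auto simp: compatible_words_def)
      moreover have "fst q \<in> set (map fst qs)" using q by simp
      moreover have "map fst qs \<in> Red (inv w)" using qs by (simp add: compatible_words_def)
      ultimately show "q \<in> ?A" by (metis UN_I atMost_iff mem_Times_iff)
    qed
    ultimately show "qs \<in> {qs. set qs \<subseteq> ?A \<and> length qs = card (inversions w)}" by blast
  qed
qed

text \<open>The conditions on fillings are split: \<open>fills\<close> will match linear extensions,
  \<open>flagged\<close> the bounds by letter values.\<close>

fun fills :: "(int \<Rightarrow> nat) \<Rightarrow> ltree \<Rightarrow> bool" where
  "fills \<kappa> Leaf \<longleftrightarrow> True"
| "fills \<kappa> (Node l (c, a) r) \<longleftrightarrow> fills \<kappa> l \<and> fills \<kappa> r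
    \<and> (l \<noteq> Leaf \<longrightarrow> \<kappa> c \<le> \<kappa> (fst (value l))) \<and> (r \<noteq> Leaf \<longrightarrow> \<kappa> c < \<kappa> (fst (value r)))"

fun flagged :: "(int \<Rightarrow> nat) \<Rightarrow> ltree \<Rightarrow> bool" where
  "flagged \<kappa> Leaf \<longleftrightarrow> True"
| "flagged \<kappa> (Node l (c, a) r) \<longleftrightarrow> flagged \<kappa> l \<and> flagged \<kappa> r
    \<and> int (\<kappa> c) \<le> leftmost (map_tree fst (Node l (c, a) r))"

lemma value_map_tree: "t \<noteq> Leaf \<Longrightarrow> value (map_tree f t) = f (value t)"
  by (cases t) auto

lemma all_subtrees_Node:
  "(\<forall>l' u r'. Node l' u r' \<in> subtrees (Node l x r) \<longrightarrow> P l' u r') \<longleftrightarrow> P l x r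
    \<and> (\<forall>l' u r'. Node l' u r' \<in> subtrees l \<longrightarrow> P l' u r') \<and> (\<forall>l' u r'. Node l' u r' \<in> subtrees r \<longrightarrow> P l' u r')"
  by auto

lemma filling_conditions_iff:
  "(\<forall>l u r. Node l u r \<in> subtrees (map_tree fst t) \<longrightarrow> int (\<kappa> u) \<le> leftmost (Node l u r)
      \<and> (l \<noteq> Leaf \<longrightarrow> \<kappa> (value l) \<ge> \<kappa> u) \<and> (r \<noteq> Leaf \<longrightarrow> \<kappa> (value r) > \<kappa> u))
    \<longleftrightarrow> fills \<kappa> t \<and> flagged \<kappa> t"
proof (induction t)
  case (Node l x r)
  obtain c a where x: "x = (c, a)" by (cases x)
  show ?case
    unfolding tree.map all_subtrees_Node Node.IH
    by (auto simp: x value_map_tree simp del: leftmost.simps)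
qed simp

text \<open>The letter of a node without children has the canonical label as its value; from there the flag
  condition propagates upwards, because a right child raises the value strictly while the left end of
  its subtree is one step to the right of the parent.\<close>

lemma flagged_if_bounded:
  assumes "spans t lo hi" "lbs t" "fills \<kappa> t" "\<forall>(c, a)\<in>set_tree t. int (\<kappa> c) \<le> fst a"
  shows "flagged \<kappa> t \<and> (t \<noteq> Leaf \<longrightarrow> int (\<kappa> (fst (value t))) \<le> lo)"
  using assms
proof (induction t lo hi rule: spans.induct)
  case (2 l c a r lo hi)
  have l: "flagged \<kappa> l" "l \<noteq> Leaf \<Longrightarrow> int (\<kappa> (fst (value l))) \<le> lo"
    using 2 by auto
  have r: "flagged \<kappa> r" "r \<noteq> Leaf \<Longrightarrow> int (\<kappa> (fst (value r))) \<le> c + 1"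
    using 2 by auto
  have "int (\<kappa> c) \<le> lo"
  proof (cases "l = Leaf")
    case False
    then show ?thesis using l(2) 2(5) by auto
  next
    case True
    then have "lo = c" using 2(3) by simp
    show ?thesis
    proof (cases "r = Leaf")
      case False
      then show ?thesis using r(2) 2(5) \<open>lo = c\<close> by auto
    next
      case r: True
      then have "fst a = c" using 2(4) True by simp
      then show ?thesis using 2(6) \<open>lo = c\<close> by simp
    qed
  qed
  then show ?case
    using l(1) r(1) leftmost_spans [OF 2(3)] by (simp del: leftmost.simps)
qed simp

text \<open>The flag is the left end of the interval of the subtree, and the value of the letter
  lies in that interval.\<close>

lemma bounded_if_flagged:
  assumes "spans t lo hi" "lbs t" "flagged \<kappa> t"
  shows "\<forall>(c, a)\<in>set_tree t. int (\<kappa> c) \<le> fst a"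
  using assms
proof (induction t lo hi rule: spans.induct)
  case (2 l c a r lo hi)
  have "int (\<kappa> c) \<le> lo"
    using 2(5) leftmost_spans [OF 2(3)] by (simp del: leftmost.simps)
  also have "lo \<le> fst a"
    using 2(4) spans_canon [OF 2(3)] by auto
  finally show ?case using 2 by auto
qed simp

text \<open>A left child has a smaller letter than its parent, so it comes first already when the
  indices are equal; a right child has a larger letter and needs a strictly larger index. This is
  the source of the weak and strict inequalities.\<close>

lemma ordered_iff_fills:
  assumes "lbs t"
    and "\<And>c a c' a'. (c, a) \<in> set_tree t \<Longrightarrow> (c', a') \<in> set_tree t \<Longrightarrow>
      a' \<in> pre W a \<longleftrightarrow> prec (a', \<kappa> c') (a, \<kappa> c)"
  shows "ordered W t \<longleftrightarrow> fills \<kappa> t"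
  using assms
proof (induction W t rule: ordered.induct)
  case (2 W l c a r)
  have in_tree: "(fst (value s), snd (value s)) \<in> set_tree s" if "s \<noteq> Leaf" for s :: ltree
    using that by (cases s) auto
  have l: "snd (value l) \<in> pre W a \<longleftrightarrow> \<kappa> c \<le> \<kappa> (fst (value l))" if "l \<noteq> Leaf"
  proof -
    have "snd (value l) \<in> pre W a \<longleftrightarrow> prec (snd (value l), \<kappa> (fst (value l))) (a, \<kappa> c)"
      using in_tree [OF that] by (intro 2(4)) auto
    then show ?thesis using 2(3) that by (auto simp: prec_def)
  qed
  have r: "snd (value r) \<in> pre W a \<longleftrightarrow> \<kappa> c < \<kappa> (fst (value r))" if "r \<noteq> Leaf"
  proof -
    have "snd (value r) \<in> pre W a \<longleftrightarrow> prec (snd (value r), \<kappa> (fst (value r))) (a, \<kappa> c)"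
      using in_tree [OF that] by (intro 2(4)) auto
    then show ?thesis using 2(3) that by (auto simp: prec_def)
  qed
  have "ordered W l \<longleftrightarrow> fills \<kappa> l"
    by (rule 2(1); (rule 2(4))?) (use 2(3) in auto)
  moreover have "ordered W r \<longleftrightarrow> fills \<kappa> r"
    by (rule 2(2); (rule 2(4))?) (use 2(3) in auto)
  ultimately show ?case using l r by auto
qed simp

lemma pre_sorted_prec:
  assumes "sorted_wrt prec qs" "distinct (map fst qs)" "(a, k) \<in> set qs" "(b, m) \<in> set qs"
  shows "b \<in> pre (map fst qs) a \<longleftrightarrow> prec (b, m) (a, k)"
  using assms
proof (induction qs)
  case (Cons q qs)
  consider "q = (a, k)" | "q = (b, m)" "b \<noteq> a" | "(a, k) \<in> set qs" "(b, m) \<in> set qs" "fst q \<noteq> a" "fst q \<noteq> b"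
    using Cons.prems by (force simp: rev_image_eqI)
  then show ?case
  proof cases
    case 1
    then show ?thesis
      using Cons.prems by (auto simp: prec_def)
  next
    case 2
    then show ?thesis
      using Cons.prems by auto
  next
    case 3
    then show ?thesis
      using Cons by auto
  qed
qed simp

lemma Supp_map_tree: "Supp ((map_tree fst) ` T) = fst ` nodes T"
  by (auto simp: Supp_def nodes_def tree.set_map)

lemma inj_on_fst_nodes:
  assumes "tableau T"
  shows "inj_on fst (nodes T)"
proof (rule inj_onI)
  fix x y assume "x \<in> nodes T" "y \<in> nodes T" and eq: "fst x = fst y"
  then obtain s t where st: "s \<in> T" "x \<in> set_tree s" "t \<in> T" "y \<in> set_tree t"
    by (auto simp: nodes_def)
  then have "fst x \<in> canon s" "fst x \<in> canon t"
    unfolding canon_def using eq by (metis imageI)+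
  then have "s = t"
    using tree_at_eq [OF assms] st by metis
  moreover obtain lo hi where "spans t lo hi"
    using assms st(3) unfolding tableau_def by blast
  ultimately show "x = y"
    using inj_onD [OF inj_on_fst_spans eq] st by blast
qed

lemma nodes_letter_unique:
  assumes "tableau T" "(c, a) \<in> nodes T" "(c', a) \<in> nodes T"
  shows "c = c'"
  using assms inj_onD [of snd "nodes T" "(c, a)" "(c', a)"] by (simp add: tableau_def)

lemma finite_nodes: "tableau T \<Longrightarrow> finite (nodes T)"
  by (auto simp: tableau_def nodes_def)

text \<open>A filling in the form in which \<open>prec\<close> can sort it into a word with
  indices.\<close>

definition filling_graph :: "ltree set \<Rightarrow> (int \<Rightarrow> nat) \<Rightarrow> (letter \<times> nat) set" where
  "filling_graph T \<kappa> = (\<lambda>(c, a). (a, \<kappa> c)) ` nodes T"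

lemma compatible_words_iff_filling:
  assumes T: "tableau T" and qs: "sorted_wrt prec qs" "set qs = filling_graph T \<kappa>"
    and \<kappa>: "\<kappa> \<in> extensional (fst ` nodes T)"
  shows "qs \<in> compatible_words {W. linear_extension T W} \<longleftrightarrow> \<kappa> \<in> forest_fillings (map_tree fst ` T)"
proof -
  have "inj_on fst (set qs)"
    unfolding qs(2) filling_graph_def by (auto simp: inj_on_def dest: nodes_letter_unique [OF T])
  then have dist: "distinct (map fst qs)"
    using sorted_prec_distinct [OF qs(1)] by (simp add: distinct_map)
  have set: "set (map fst qs) = snd ` nodes T"
    by (force simp: qs(2) filling_graph_def image_image case_prod_unfold)
  have ord: "ordered (map fst qs) t \<longleftrightarrow> fills \<kappa> t" if "t \<in> T" for t
  proof (rule ordered_iff_fills)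
    show "lbs t" using T that by (simp add: tableau_def)
    fix c a c' a' assume "(c, a) \<in> set_tree t" "(c', a') \<in> set_tree t"
    then have "(c, a) \<in> nodes T" "(c', a') \<in> nodes T" using that by (auto simp: nodes_def)
    then have "(a, \<kappa> c) \<in> set qs" "(a', \<kappa> c') \<in> set qs"
      by (force simp: qs(2) filling_graph_def)+
    then show "a' \<in> pre (map fst qs) a \<longleftrightarrow> prec (a', \<kappa> c') (a, \<kappa> c)"
      by (rule pre_sorted_prec [OF qs(1) dist])
  qed
  \<comment> \<open>The two bounds are exchanged for a whole tree, under the assumption
    \<open>fills \<kappa> t\<close>.\<close>
  have flag: "flagged \<kappa> t \<longleftrightarrow> (\<forall>(c, a)\<in>set_tree t. int (\<kappa> c) \<le> fst a)" if "t \<in> T" "fills \<kappa> t" for t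
  proof -
    obtain lo hi where "spans t lo hi" "lbs t"
      using T \<open>t \<in> T\<close> unfolding tableau_def by blast
    then show ?thesis using flagged_if_bounded bounded_if_flagged that(2) by blast
  qed
  have "qs \<in> compatible_words {W. linear_extension T W} \<longleftrightarrow>
      (\<forall>t\<in>T. fills \<kappa> t) \<and> (\<forall>(c, a)\<in>nodes T. 1 \<le> \<kappa> c \<and> int (\<kappa> c) \<le> fst a)"
  proof -
    have "linear_extension T (map fst qs) \<longleftrightarrow> (\<forall>t\<in>T. fills \<kappa> t)"
      unfolding linear_extension_def using dist set ord by blast
    moreover have "(\<forall>(a, k)\<in>set qs. 1 \<le> k \<and> int k \<le> fst a)
        \<longleftrightarrow> (\<forall>(c, a)\<in>nodes T. 1 \<le> \<kappa> c \<and> int (\<kappa> c) \<le> fst a)"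
      unfolding qs(2) filling_graph_def ball_simps(9) by (simp add: case_prod_unfold)
    ultimately show ?thesis
      unfolding compatible_words_def mem_Collect_eq using qs(1) by blast
  qed
  also have "\<dots> \<longleftrightarrow> (\<forall>t\<in>T. fills \<kappa> t \<and> (\<forall>(c, a)\<in>set_tree t. int (\<kappa> c) \<le> fst a))
      \<and> (\<forall>c\<in>fst ` nodes T. 1 \<le> \<kappa> c)"
    unfolding nodes_def by fastforce
  also have "\<dots> \<longleftrightarrow> (\<forall>t\<in>T. fills \<kappa> t \<and> flagged \<kappa> t) \<and> (\<forall>c\<in>fst ` nodes T. 1 \<le> \<kappa> c)"
    using flag by blast
  also have "\<dots> \<longleftrightarrow> \<kappa> \<in> forest_fillings (map_tree fst ` T)"
    unfolding forest_fillings_def Supp_map_tree mem_Collect_eq PiE_iff ball_simps(9) filling_conditions_iff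
    using \<kappa> by auto
  finally show ?thesis .
qed

lemma weight_filling_graph:
  assumes T: "tableau T" and qs: "sorted_wrt prec qs" "set qs = filling_graph T \<kappa>"
  shows "weight qs = (\<Prod>v\<in>fst ` nodes T. X (\<kappa> v))"
proof -
  have inj: "inj_on (\<lambda>(c, a). (a, \<kappa> c)) (nodes T)"
    by (auto simp: inj_on_def dest: nodes_letter_unique [OF T])
  have "weight qs = (\<Prod>q\<in>set qs. X (snd q))"
    unfolding weight_def by (rule prod.distinct_set_conv_list [symmetric, OF sorted_prec_distinct [OF qs(1)]])
  also have "\<dots> = (\<Prod>x\<in>nodes T. X (\<kappa> (fst x)))"
    unfolding qs(2) filling_graph_def prod.reindex [OF inj] by (simp add: case_prod_unfold)
  also have "\<dots> = (\<Prod>v\<in>fst ` nodes T. X (\<kappa> v))"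
    by (simp add: prod.reindex [OF inj_on_fst_nodes [OF T]])
  finally show ?thesis .
qed

lemma ex_filling_of_word:
  assumes T: "tableau T" and qs: "qs \<in> compatible_words {W. linear_extension T W}"
  shows "\<exists>\<kappa>\<in>extensional (fst ` nodes T). set qs = filling_graph T \<kappa>"
proof -
  \<comment> \<open>A canonical label determines its node and thereby the letter whose index is
    looked up in the word; \<open>restrict\<close> fixes the values outside the support.\<close>
  let ?label = "\<lambda>c. snd (inv_into (nodes T) fst c)"
  define \<kappa> where "\<kappa> = restrict (\<lambda>c. the (map_of qs (?label c))) (fst ` nodes T)"
  have dist: "distinct (map fst qs)" and set: "fst ` set qs = snd ` nodes T"
    using qs by (auto simp: compatible_words_def linear_extension_def)
  have \<kappa>: "\<kappa> c = k" if "(c, a) \<in> nodes T" "(a, k) \<in> set qs" for c a k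
  proof -
    have "inv_into (nodes T) fst c = (c, a)"
      using inv_into_f_f [OF inj_on_fst_nodes [OF T] that(1)] by simp
    moreover have "map_of qs a = Some k" using dist that(2) by simp
    ultimately show ?thesis using that(1) by (force simp: \<kappa>_def)
  qed
  have "set qs = filling_graph T \<kappa>"
  proof (intro set_eqI iffI)
    fix q assume "q \<in> set qs"
    moreover from this have "fst q \<in> snd ` nodes T" using set by blast
    then obtain c where "(c, fst q) \<in> nodes T" by auto
    ultimately show "q \<in> filling_graph T \<kappa>"
      using \<kappa> [of c "fst q" "snd q"] by (force simp: filling_graph_def)
  next
    fix q assume "q \<in> filling_graph T \<kappa>"
    then obtain c a where q: "q = (a, \<kappa> c)" "(c, a) \<in> nodes T" by (auto simp: filling_graph_def)
    then have "a \<in> fst ` set qs" using set by force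
    then obtain k where "(a, k) \<in> set qs" by auto
    then show "q \<in> set qs" using \<kappa> q by metis
  qed
  moreover have "\<kappa> \<in> extensional (fst ` nodes T)" by (simp add: \<kappa>_def)
  ultimately show ?thesis by blast
qed

lemma filling_graph_inj:
  assumes "\<kappa> \<in> extensional (fst ` nodes T)" "\<kappa>' \<in> extensional (fst ` nodes T)"
    "tableau T" "filling_graph T \<kappa> = filling_graph T \<kappa>'"
  shows "\<kappa> = \<kappa>'"
proof (rule extensionalityI [OF assms(1,2)])
  fix c assume "c \<in> fst ` nodes T"
  then obtain a where a: "(c, a) \<in> nodes T" by auto
  then have "(a, \<kappa> c) \<in> filling_graph T \<kappa>'"
    unfolding assms(4) [symmetric] by (force simp: filling_graph_def)
  then obtain c' where "(c', a) \<in> nodes T" "\<kappa> c = \<kappa>' c'"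
    by (auto simp: filling_graph_def)
  then show "\<kappa> c = \<kappa>' c" using a nodes_letter_unique [OF assms(3)] by metis
qed

text \<open>Sorting the graph of a filling is a bijection onto the compatible words; a set has only
  one sorted list, so the choice in \<open>g\<close> is immaterial.\<close>

lemma sum_compatible_words_linear_extensions:
  assumes T: "tableau T"
  shows "(\<Sum>qs\<in>compatible_words {W. linear_extension T W}. weight qs) = forest_poly (map_tree fst ` T)"
proof -
  define g where "g \<kappa> = (SOME qs. sorted_wrt prec qs \<and> set qs = filling_graph T \<kappa>)" for \<kappa>
  have "\<exists>qs. sorted_wrt prec qs \<and> set qs = filling_graph T \<kappa>" for \<kappa>
    by (rule ex_sorted_prec) (simp add: filling_graph_def finite_nodes [OF T])
  then have g: "sorted_wrt prec (g \<kappa>)" "set (g \<kappa>) = filling_graph T \<kappa>" for \<kappa>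
    using someI_ex [of "\<lambda>qs. sorted_wrt prec qs \<and> set qs = filling_graph T \<kappa>"] unfolding g_def by blast+
  let ?K = "forest_fillings (map_tree fst ` T)"
  have ext: "\<kappa> \<in> extensional (fst ` nodes T)" if "\<kappa> \<in> ?K" for \<kappa>
    using that by (simp add: forest_fillings_def Supp_map_tree PiE_iff)
  have "bij_betw g ?K (compatible_words {W. linear_extension T W})"
    unfolding bij_betw_def
  proof (intro conjI inj_onI equalityI subsetI)
    fix \<kappa> \<kappa>' assume "\<kappa> \<in> ?K" "\<kappa>' \<in> ?K" "g \<kappa> = g \<kappa>'"
    then show "\<kappa> = \<kappa>'"
      using filling_graph_inj [OF ext ext T] g(2) by metis
  next
    fix qs assume "qs \<in> g ` ?K"
    then obtain \<kappa> where "\<kappa> \<in> ?K" "qs = g \<kappa>" by blast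
    then show "qs \<in> compatible_words {W. linear_extension T W}"
      using compatible_words_iff_filling [OF T g ext] by blast
  next
    fix qs assume qs: "qs \<in> compatible_words {W. linear_extension T W}"
    then obtain \<kappa> where \<kappa>: "\<kappa> \<in> extensional (fst ` nodes T)" "set qs = filling_graph T \<kappa>"
      using ex_filling_of_word [OF T] by blast
    have sorted: "sorted_wrt prec qs" using qs by (simp add: compatible_words_def)
    then have "\<kappa> \<in> ?K"
      using compatible_words_iff_filling [OF T sorted \<kappa>(2,1)] qs by blast
    moreover have "qs = g \<kappa>"
      by (rule sorted_prec_unique [OF sorted g(1)]) (simp add: g(2) \<kappa>(2))
    ultimately show "qs \<in> g ` ?K" by blast
  qed
  then have "(\<Sum>qs\<in>compatible_words {W. linear_extension T W}. weight qs) = (\<Sum>\<kappa>\<in>?K. weight (g \<kappa>))"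
    by (rule sum.reindex_bij_betw [symmetric])
  also have "\<dots> = forest_poly (map_tree fst ` T)"
    by (simp add: forest_poly_def Supp_map_tree weight_filling_graph [OF T g])
  finally show ?thesis .
qed

lemma indexed_forest_tableau:
  assumes T: "tableau T"
  shows "indexed_forest (map_tree fst ` T)"
proof -
  have "\<exists>a b. inorder (map_tree fst t) = [a..b]" if "t \<in> T" for t
  proof -
    obtain lo hi where "spans t lo hi" using T \<open>t \<in> T\<close> unfolding tableau_def by blast
    then show ?thesis using inorder_spans by blast
  qed
  moreover have "2 \<le> \<bar>i - j\<bar>" if "s \<in> T" "t \<in> T" "map_tree fst s \<noteq> map_tree fst t"
    "i \<in> set_tree (map_tree fst s)" "j \<in> set_tree (map_tree fst t)" for s t i j
  proof -
    have "s \<noteq> t" "i \<in> canon s" "j \<in> canon t"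
      using that(3-) by (auto simp: canon_def tree.set_map)
    then show ?thesis using T that(1,2) unfolding tableau_def by blast
  qed
  ultimately show ?thesis
    using T unfolding indexed_forest_def tableau_def by auto
qed

section \<open>The classes of reduced words and the expansion\<close>

lemma equiv_word_equiv: "equiv injective_words word_equiv"
  by (auto simp: equiv_def refl_on_def sym_def trans_def word_equiv_def)

lemma word_equiv_class:
  assumes "W \<in> injective_words"
  shows "word_equiv `` {W} = {V. linear_extension (P_tableau W) V}"
proof (intro equalityI subsetI)
  fix V assume "V \<in> word_equiv `` {W}"
  then have "distinct V" "P_tableau V = P_tableau W"
    by (auto simp: word_equiv_def injective_words_def)
  then show "V \<in> {V. linear_extension (P_tableau W) V}"
    using tableau_P_tableau [of V] by simp
next
  have W: "tableau (P_tableau W)" "linear_extension (P_tableau W) W"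
    using assms tableau_P_tableau by (auto simp: injective_words_def)
  fix V assume "V \<in> {V. linear_extension (P_tableau W) V}"
  then have V: "linear_extension (P_tableau W) V" by simp
  then have "set V = set W" "distinct V"
    using W(2) by (auto simp: linear_extension_def)
  then have "V \<in> injective_words" using assms by (auto simp: injective_words_def)
  then show "V \<in> word_equiv `` {W}"
    using P_tableau_linear_extension [OF W(1) V] assms by (simp add: word_equiv_def)
qed

lemma class_forest_eq:
  assumes "W \<in> injective_words"
  shows "class_forest (word_equiv `` {W}) = map_tree fst ` P_tableau W"
  unfolding class_forest_def
proof (rule the_equality)
  show "\<forall>V\<in>word_equiv `` {W}. forest_of V = map_tree fst ` P_tableau W"
    by (auto simp: word_equiv_def forest_of_def)
next
  fix F assume "\<forall>V\<in>word_equiv `` {W}. forest_of V = F"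
  moreover have "W \<in> word_equiv `` {W}" using assms by (simp add: word_equiv_def)
  ultimately show "F = map_tree fst ` P_tableau W" by (auto simp: forest_of_def)
qed

text \<open>A class is connected by commutations of distant letters, under which
  \<open>Red (inv w)\<close> is closed, so a class that meets it lies inside it.\<close>

lemma red_classes_iff:
  assumes "w permutes {1..n}"
  shows "C \<in> red_classes w \<longleftrightarrow> (\<exists>W\<in>Red (inv w). C = word_equiv `` {W})"
proof
  assume "C \<in> red_classes w"
  then obtain W where W: "W \<in> injective_words" "C = word_equiv `` {W}" "C \<subseteq> Red (inv w)"
    by (auto simp: red_classes_def quotient_def)
  then have "W \<in> C" by (simp add: word_equiv_def)
  then show "\<exists>W\<in>Red (inv w). C = word_equiv `` {W}" using W by blast
next
  assume "\<exists>W\<in>Red (inv w). C = word_equiv `` {W}"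
  then obtain W where W: "W \<in> Red (inv w)" "C = word_equiv `` {W}" by blast
  then have inj: "W \<in> injective_words" using Red_injective [OF assms] by blast
  then have lin: "tableau (P_tableau W)" "linear_extension (P_tableau W) W"
    using tableau_P_tableau by (auto simp: injective_words_def)
  have "C \<subseteq> Red (inv w)"
    unfolding W(2) word_equiv_class [OF inj]
    using linear_extensions_connected [OF lin _ swap_closed_Red [OF assms] W(1)] by blast
  then show "C \<in> red_classes w"
    using inj W(2) by (auto simp: red_classes_def quotient_def)
qed

lemma Union_red_classes:
  assumes "w permutes {1..n}"
  shows "Red (inv w) = \<Union> (red_classes w)"
proof (intro equalityI subsetI)
  fix W assume W: "W \<in> Red (inv w)"
  then have "W \<in> word_equiv `` {W}"
    using Red_injective [OF assms] by (auto simp: word_equiv_def)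
  then show "W \<in> \<Union> (red_classes w)"
    using W red_classes_iff [OF assms] by blast
qed (auto simp: red_classes_def)

lemma finite_red_classes:
  assumes "w permutes {1..n}"
  shows "finite (red_classes w)"
proof (rule finite_subset)
  show "red_classes w \<subseteq> Pow (Red (inv w))" by (auto simp: red_classes_def)
  show "finite (Pow (Red (inv w)))"
    by (simp add: Red_inv [OF assms] finite_chains [OF assms])
qed

lemma schubert_eq_sum_red_classes:
  assumes w: "w permutes {1..n}"
  shows "schubert w = (\<Sum>C\<in>red_classes w. forest_poly (class_forest C))"
proof -
  have fin: "finite (red_classes w)"
    using finite_red_classes [OF w] .
  have "compatible_words (Red (inv w)) = (\<Union>C\<in>red_classes w. compatible_words C)"
    unfolding Union_red_classes [OF w] by (auto simp: compatible_words_def)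
  moreover have "(\<Sum>qs\<in>(\<Union>C\<in>red_classes w. compatible_words C). weight qs)
      = (\<Sum>C\<in>red_classes w. \<Sum>qs\<in>compatible_words C. weight qs)"
  proof (rule sum.UNION_disjoint [OF fin])
    show "\<forall>C\<in>red_classes w. finite (compatible_words C)"
      by (intro ballI finite_subset [OF _ finite_compatible_words_Red [OF w]])
        (auto simp: red_classes_def compatible_words_def)
    show "\<forall>C\<in>red_classes w. \<forall>D\<in>red_classes w. C \<noteq> D \<longrightarrow> compatible_words C \<inter> compatible_words D = {}"
    proof (intro ballI impI)
      fix C D assume "C \<in> red_classes w" "D \<in> red_classes w" "C \<noteq> D"
      then have "C \<inter> D = {}"
        using quotient_disj [OF equiv_word_equiv] by (auto simp: red_classes_def)
      then show "compatible_words C \<inter> compatible_words D = {}"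
        by (auto simp: compatible_words_def)
    qed
  qed
  moreover have "(\<Sum>qs\<in>compatible_words C. weight qs) = forest_poly (class_forest C)" if C: "C \<in> red_classes w" for C
  proof -
    obtain W where W: "W \<in> Red (inv w)" "C = word_equiv `` {W}"
      using C unfolding red_classes_iff [OF w] by blast
    then have inj: "W \<in> injective_words" using Red_injective [OF w] by blast
    then have "tableau (P_tableau W)"
      using tableau_P_tableau by (auto simp: injective_words_def)
    then show ?thesis
      unfolding W(2) class_forest_eq [OF inj] unfolding word_equiv_class [OF inj]
      by (rule sum_compatible_words_linear_extensions)
  qed
  ultimately show ?thesis
    using sum_compatible_words_Red [OF w] schubert_eq_bjs [OF w] by simp
qed

theorem theorem1p4:
  fixes w :: "nat \<Rightarrow> nat"
  assumes "w permutes {1..}" and "finite {i. w i \<noteq> i}"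
  shows "Red (inv w) = \<Union> (red_classes w)
    \<and> finite (red_classes w)
    \<and> (\<forall>C\<in>red_classes w. indexed_forest (class_forest C) \<and> (\<forall>W\<in>C. forest_of W = class_forest C))
    \<and> schubert w = (\<Sum>C\<in>red_classes w. forest_poly (class_forest C))
    \<and> (\<exists>c :: forest \<Rightarrow> int. (\<forall>F. 0 \<le> c F) \<and> finite {F. c F \<noteq> 0} \<and> (\<forall>F. c F \<noteq> 0 \<longrightarrow> indexed_forest F)
        \<and> schubert w = (\<Sum>F | c F \<noteq> 0. of_int (c F) * forest_poly F))"
proof -
  obtain n where w: "w permutes {1..n}"
    using permutes_finite_supportD [OF assms] by blast
  note fin = finite_red_classes [OF w] and sch = schubert_eq_sum_red_classes [OF w]
  have forest: "indexed_forest (class_forest C) \<and> (\<forall>W\<in>C. forest_of W = class_forest C)"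
    if C: "C \<in> red_classes w" for C
  proof -
    obtain W where W: "W \<in> Red (inv w)" "C = word_equiv `` {W}"
      using C unfolding red_classes_iff [OF w] by blast
    then have inj: "W \<in> injective_words" using Red_injective [OF w] by blast
    then have "tableau (P_tableau W)"
      using tableau_P_tableau by (auto simp: injective_words_def)
    then show ?thesis
      unfolding W(2) class_forest_eq [OF inj]
      using indexed_forest_tableau by (auto simp: forest_of_def word_equiv_def)
  qed
  \<comment> \<open>Different classes may share a forest, so the coefficient counts them.\<close>
  define c where "c F = int (card {C \<in> red_classes w. class_forest C = F})" for F
  have c: "c F \<noteq> 0 \<longleftrightarrow> F \<in> class_forest ` red_classes w" for F
    using fin by (auto simp: c_def)
  then have supp: "{F. c F \<noteq> 0} = class_forest ` red_classes w" by blast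
  have "schubert w = (\<Sum>F\<in>class_forest ` red_classes w.
      \<Sum>C\<in>{C \<in> red_classes w. class_forest C = F}. forest_poly (class_forest C))"
    unfolding sch by (rule sum.image_gen [OF fin])
  also have "\<dots> = (\<Sum>F\<in>class_forest ` red_classes w. of_int (c F) * forest_poly F)"
    by (rule sum.cong) (auto simp: c_def)
  finally have expansion: "schubert w = (\<Sum>F | c F \<noteq> 0. of_int (c F) * forest_poly F)"
    unfolding supp .
  have "(\<forall>F. 0 \<le> c F) \<and> finite {F. c F \<noteq> 0} \<and> (\<forall>F. c F \<noteq> 0 \<longrightarrow> indexed_forest F)
      \<and> schubert w = (\<Sum>F | c F \<noteq> 0. of_int (c F) * forest_poly F)"
    using fin forest expansion c unfolding supp by (auto simp: c_def [abs_def])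
  then show ?thesis
    using Union_red_classes [OF w] fin forest sch by blast
qed

end
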